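(* Let $\mu$ be an $s$-regular Radon measure on $\mathbb{R}^d$ and let $C=\operatorname{spt}\mu$. Then for any $x\in C$, $$\omega(C^x)=\{\operatorname{spt}\nu \;:\; \nu\in\operatorname{Tan}(\mu,x)\}.$$
   Context: $\operatorname{spt}\nu$ is the smallest closed set $A$ with $\nu(\mathbb{R}^d\setminus A)=0$. For $s>0$, a Borel measure $\mu$ on $\mathbb{R}^d$ is $s$-regular (Ahlfors-David $s$-regular) if there is $\tau>0$ such that $\tau^{-1}r^s\le\mu(B(x,r))\le\tau r^s$ for all $x\in\operatorname{spt}\mu$ and $0<r\le\operatorname{diam}(\operatorname{spt}\mu)$, where $B(x,r)$ is the closed ball. Tangent measures: for a Radon measure $\mu$ on $\mathbb{R}^d$, $a\in\mathbb{R}^d$ and $r>0$, put $\mu_{a,r}(A)=\mu(a+rA)$. A non-zero Radon measure $\nu$ on $\mathbb{R}^d$ is a tangent measure of $\mu$ at $a$ if there are sequences $r_i>0$, $c_i>0$ with $r_i\to0$ and $c_i\mu_{a,r_i}\to\nu$ weakly, i.e. $c_i\int f\,d\mu_{a,r_i}\to\int f\,d\nu$ for all compactly supported continuous $f:\mathbb{R}^d\to\mathbb{R}$. $\operatorname{Tan}(\mu,a)$ is the set of all tangent measures of $\mu$ at $a$. Limit models: $\Gamma$ is the set of all closed subsets of $\mathbb{R}^d$ (including $\emptyset$) with the hit-and-miss topology $\rho$ generated by the families $\{F\in\Gamma:F\cap K=\emptyset\}$ ($K$ compact) and $\{F\in\Gamma:F\cap G\neq\emptyset\}$ ($G$ open).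 Equivalently, $F_n\to F$ in $\rho$ iff (i) every $x\in F$ is the limit of some sequence $x_n\in F_n$, and (ii) for every subsequence $(n_k)$ and every convergent sequence $x_{n_k}\in F_{n_k}$, $\lim_k x_{n_k}\in F$. For a non-empty closed $G$ and $x\in G$, $G^x=\{y-x:y\in G\}$ and $\omega(G^x)=\{F\in\Gamma:\exists\, r_k>0,\ r_k\to0,\ \tfrac1{r_k}G^x\to F \text{ in }\rho\}$. *)

theory Defs
  imports "HOL-Analysis.Analysis"
begin

section \<open>Radon measures, supports and Ahlfors--David regularity\<close>

text \<open>A measure in HOL is carried by its \<open>\<sigma>\<close>-algebra, so being a Borel measure is the condition
  \<open>sets M = sets borel\<close>.\<close>

definition radon_measure :: "'a::topological_space measure \<Rightarrow> bool" where
  "radon_measure M \<longleftrightarrow>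
     sets M = sets borel \<and>
     (\<forall>K. compact K \<longrightarrow> emeasure M K < \<infinity>) \<and>
     (\<forall>V. open V \<longrightarrow> emeasure M V = (SUP K\<in>{K. compact K \<and> K \<subseteq> V}. emeasure M K)) \<and>
     (\<forall>A\<in>sets borel. emeasure M A = (INF V\<in>{V. open V \<and> A \<subseteq> V}. emeasure M V))"

text \<open>\<open>LEAST\<close> is taken with respect to inclusion; the lemmas below show that the minimum exists for
  every Borel measure on a second countable space.\<close>

definition spt :: "'a::topological_space measure \<Rightarrow> 'a set" where
  "spt M = (LEAST A. closed A \<and> emeasure M (- A) = 0)"

lemma
  fixes M :: "'a::second_countable_topology measure"
  assumes "sets M = sets borel"
  shows closed_spt: "closed (spt M)"
    and emeasure_Compl_spt: "emeasure M (- spt M) = 0"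
    and spt_least: "closed A \<Longrightarrow> emeasure M (- A) = 0 \<Longrightarrow> spt M \<subseteq> A"
proof -
  define P where "P = (\<lambda>A. closed A \<and> emeasure M (- A) = 0)"
  define S where "S = \<Inter> (Collect P)"
  obtain \<F> where \<F>: "\<F> \<subseteq> uminus ` Collect P" "countable \<F>" "\<Union>\<F> = \<Union> (uminus ` Collect P)"
    by (rule Lindelof[of "uminus ` Collect P"]) (auto simp: P_def)
  have "B \<in> null_sets M" if "B \<in> \<F>" for B
    using that \<F>(1) assms by (auto simp: P_def null_sets_def)
  then have "(\<Union>B\<in>\<F>. B) \<in> null_sets M"
    using \<F>(2) by (intro null_sets_UN') auto
  moreover have "- S = (\<Union>B\<in>\<F>. B)"
    using \<F>(3) by (auto simp: S_def)
  ultimately have "emeasure M (- S) = 0"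
    by (simp add: null_sets_def)
  moreover have "closed S"
    by (auto simp: S_def P_def)
  ultimately have "P S"
    by (simp add: P_def)
  moreover have "S \<subseteq> A" if "P A" for A
    using that by (auto simp: S_def)
  ultimately have "spt M = S"
    unfolding spt_def P_def by (intro Least_equality) auto
  then show "closed (spt M)" "emeasure M (- spt M) = 0"
    "closed A \<Longrightarrow> emeasure M (- A) = 0 \<Longrightarrow> spt M \<subseteq> A"
    using \<open>P S\<close> \<open>\<And>A. P A \<Longrightarrow> S \<subseteq> A\<close> by (auto simp: P_def)
qed

text \<open>The library's \<open>diameter\<close> is real-valued and meaningless on unbounded sets, whereas a regular
  measure may have unbounded support; hence an extended diameter.\<close>

definition ediameter :: "'a::metric_space set \<Rightarrow> ennreal" where
  "ediameter S = (SUP p\<in>S \<times> S. ennreal (dist (fst p) (snd p)))"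

definition AD_regular :: "real \<Rightarrow> 'a::metric_space measure \<Rightarrow> bool" where
  "AD_regular s M \<longleftrightarrow>
     (\<exists>\<tau>>0. \<forall>x\<in>spt M. \<forall>r>0. ennreal r \<le> ediameter (spt M) \<longrightarrow>
        ennreal (inverse \<tau> * r powr s) \<le> emeasure M (cball x r) \<and>
        emeasure M (cball x r) \<le> ennreal (\<tau> * r powr s))"

section \<open>Tangent measures\<close>

definition blowup :: "'a::euclidean_space measure \<Rightarrow> 'a \<Rightarrow> real \<Rightarrow> 'a measure" where
  "blowup M a r = distr M borel (\<lambda>y. inverse r *\<^sub>R (y - a))"

lemma emeasure_blowup:
  fixes M :: "'a::euclidean_space measure"
  assumes M: "sets M = sets borel" and r: "r > 0" and A: "A \<in> sets borel"
  shows "emeasure (blowup M a r) A = emeasure M ((\<lambda>y. a + r *\<^sub>R y) ` A)"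
proof -
  have "(\<lambda>y. inverse r *\<^sub>R (y - a)) \<in> measurable M borel"
    using M by (simp cong: measurable_cong_sets)
  moreover have "(\<lambda>y. inverse r *\<^sub>R (y - a)) -` A = (\<lambda>y. a + r *\<^sub>R y) ` A"
  proof safe
    fix y assume "inverse r *\<^sub>R (y - a) \<in> A"
    moreover have "y = a + r *\<^sub>R (inverse r *\<^sub>R (y - a))"
      using r by simp
    ultimately show "y \<in> (\<lambda>y. a + r *\<^sub>R y) ` A"
      by (rule rev_image_eqI)
  qed (use r in simp)
  moreover have "space M = UNIV"
    using sets_eq_imp_space_eq[OF M] by simp
  ultimately show ?thesis
    using A by (simp add: blowup_def emeasure_distr)
qed

definition Tan :: "'a::euclidean_space measure \<Rightarrow> 'a \<Rightarrow> 'a measure set" where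
  "Tan M a = {N. radon_measure N \<and> emeasure N UNIV \<noteq> 0 \<and>
     (\<exists>(r :: nat \<Rightarrow> real) (c :: nat \<Rightarrow> real).
        (\<forall>i. r i > 0) \<and> (\<forall>i. c i > 0) \<and> r \<longlonglongrightarrow> 0 \<and>
        (\<forall>f :: 'a \<Rightarrow> real. continuous_on UNIV f \<and> compact (closure {x. f x \<noteq> 0}) \<longrightarrow>
           (\<lambda>i. c i * integral\<^sup>L (blowup M a (r i)) f) \<longlonglongrightarrow> integral\<^sup>L N f))}"

section \<open>Limit models\<close>

text \<open>The choice \<open>K = {}\<close> shows that the underlying set of the hit-and-miss topology consists of all
  closed sets, the empty set included.\<close>

definition hit_and_miss :: "'a::topological_space set topology" where
  "hit_and_miss = topology_generated_by
     ({{F. closed F \<and> F \<inter> K = {}} | K. compact K} \<union>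
      {{F. closed F \<and> F \<inter> G \<noteq> {}} | G. open G})"

lemma topspace_hit_and_miss: "topspace hit_and_miss = {F. closed F}"
proof -
  have "{F :: 'a set. closed F} \<in> {{F. closed F \<and> F \<inter> K = {}} | K. compact K}"
    by (rule CollectI, rule exI[of _ "{}"]) simp
  then show ?thesis
    unfolding hit_and_miss_def topology_generated_by_topspace by blast
qed

definition translate :: "'a::real_vector set \<Rightarrow> 'a \<Rightarrow> 'a set" where
  "translate G x = (\<lambda>y. y - x) ` G"

definition limit_models :: "'a::real_normed_vector set \<Rightarrow> 'a set set" where
  "limit_models H = {F. closed F \<and>
     (\<exists>r :: nat \<Rightarrow> real. (\<forall>k. r k > 0) \<and> r \<longlonglongrightarrow> 0 \<and>
        limitin hit_and_miss (\<lambda>k. (\<lambda>y. (1 / r k) *\<^sub>R y) ` H) F sequentially)}"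

end

theory Submission
  imports Defs "HOL-Probability.Helly_Selection"
begin

text \<open>If \<open>c\<^sub>k \<mu>\<^sub>k \<longlonglongrightarrow> \<nu>\<close> vaguely for blow-ups \<open>\<mu>\<^sub>k\<close> at scales \<open>r\<^sub>k\<close>, then \<open>\<nu> \<noteq> 0\<close> and the upper
  regularity bound keep \<open>c\<^sub>k r\<^sub>k\<^sup>s\<close> away from \<open>0\<close>, and the lower bound then gives every ball of fixed
  radius around a point of the dilated support a fixed amount of mass; hence the dilated supports
  converge to \<open>spt \<nu>\<close>. Conversely, along any scales the blow-ups have a vaguely convergent
  normalised subsequence with non-zero limit, whose support must be the given limit model because
  hit-and-miss limits are unique. Vague compactness is obtained from Helly's theorem on the line
  by lifting measures along a space-filling curve.\<close>

section \<open>A space-filling curve\<close>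

text \<open>Two defects separate blow-ups from Helly's theorem: their total mass may be infinite,
  and they live in several dimensions, where mass can also escape to infinity. A polynomially
  decaying weight removes the first. For the second, pushing a measure to the line needs only a
  measurable section of the curve, while coming back from the weak limit needs only continuity of
  the curve itself; no single map has to have both properties. An arctangent chart first places all
  of space inside the unit cube and infinity on its boundary, where compactly supported test
  functions leave no trace.

  Regularity speaks only of radii up to the diameter of the support, while blow-ups are tested on
  balls of every size. What is used is therefore one-sided: the lower bound at every point of the
  support but only for small radii, which suffices because the scales tend to 0, and the upper bound
  for all radii but only at the centre.\<close>

definition binary_digit :: "real \<Rightarrow> nat \<Rightarrow> int" where
  "binary_digit y k = \<lfloor>2 ^ Suc k * y\<rfloor> - 2 * \<lfloor>2 ^ k * y\<rfloor>"

text \<open>Doubling a real adds 0 or 1 to twice its floor. The bounds hold for every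
  \<open>y\<close>, which later keeps the section inside [0, 1] even for points outside the
  cube.\<close>

lemma binary_digit_bounds: "0 \<le> binary_digit y k" "binary_digit y k \<le> 1"
proof -
  have "2 ^ Suc k * y = 2 * (2 ^ k * y)"
    by simp
  then show "0 \<le> binary_digit y k" "binary_digit y k \<le> 1"
    unfolding binary_digit_def by linarith+
qed

text \<open>The partial sums telescope to the dyadic truncations \<open>q k\<close>, which lie at
  most 2^-k below \<open>y\<close>; the range [0, 1) makes \<open>q 0\<close> vanish.\<close>

lemma sums_binary_digit:
  assumes "0 \<le> y" "y < 1"
  shows "(\<lambda>k. real_of_int (binary_digit y k) / 2 ^ Suc k) sums y"
proof -
  define q where "q k = real_of_int \<lfloor>2 ^ k * y\<rfloor> / 2 ^ k" for k
  have "y - (1/2) ^ k \<le> q k" "q k \<le> y" for k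
  proof -
    have y: "y = (2 ^ k * y) / 2 ^ k"
      by simp
    have "(2 ^ k * y - 1) / 2 ^ k \<le> q k"
      unfolding q_def by (intro divide_right_mono) (linarith, simp)
    then show "y - (1/2) ^ k \<le> q k"
      by (simp add: diff_divide_distrib power_divide)
    show "q k \<le> y"
      unfolding q_def by (subst (2) y, intro divide_right_mono) auto
  qed
  moreover have "(\<lambda>k. y - (1/2) ^ k) \<longlonglongrightarrow> y - 0"
    by (intro tendsto_intros LIMSEQ_realpow_zero) auto
  ultimately have "q \<longlonglongrightarrow> y"
    by (intro tendsto_sandwich[of "\<lambda>k. y - (1/2) ^ k" q sequentially "\<lambda>_. y" y]) auto
  then have "(\<lambda>k. q (Suc k) - q k) sums (y - q 0)"
    by (rule telescope_sums)
  moreover have "q 0 = 0"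
    using assms by (simp add: q_def floor_eq_iff)
  moreover have "q (Suc k) - q k = binary_digit y k / 2 ^ Suc k" for k
    by (simp add: q_def binary_digit_def field_simps)
  ultimately show ?thesis
    by simp
qed

lemma measurable_binary_digit [measurable]: "(\<lambda>y. binary_digit y k) \<in> borel \<rightarrow>\<^sub>M count_space UNIV"
  unfolding binary_digit_def by measurable

text \<open>Digits 0 and 1 become the ternary digits 0 and 2. Without the digit 1, numbers with
  different leading digits are separated by the gap (1/3, 2/3), so a continuous function can tell
  them apart.\<close>

definition cantor_real :: "(nat \<Rightarrow> int) \<Rightarrow> real" where
  "cantor_real a = (\<Sum>m. 2 * real_of_int (a m) / 3 ^ Suc m)"

lemma sums_two_thirds: "(\<lambda>m. 2 / 3 ^ Suc m :: real) sums 1"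
proof -
  have "(\<lambda>m. 2/3 * (1/3) ^ m :: real) sums (2/3 * (1 / (1 - 1/3)))"
    by (intro sums_mult geometric_sums) simp
  then show ?thesis
    by (simp add: power_divide)
qed

context
  fixes a :: "nat \<Rightarrow> int"
  assumes a: "\<And>m. 0 \<le> a m" "\<And>m. a m \<le> 1"
begin

lemma summable_cantor_real: "summable (\<lambda>m. 2 * real_of_int (a m) / 3 ^ Suc m)"
  using a by (intro summable_comparison_test'[OF sums_summable[OF sums_two_thirds], of 0])
    (auto simp: field_simps)

lemma cantor_real_bounds: "0 \<le> cantor_real a" "cantor_real a \<le> 1"
proof -
  show "0 \<le> cantor_real a"
    unfolding cantor_real_def using a by (intro suminf_nonneg summable_cantor_real) auto
  have "cantor_real a \<le> (\<Sum>m. 2 / 3 ^ Suc m)"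
    unfolding cantor_real_def using a
    by (intro suminf_le summable_cantor_real sums_summable[OF sums_two_thirds])
      (auto simp: field_simps)
  then show "cantor_real a \<le> 1"
    using sums_two_thirds by (simp add: sums_iff)
qed

lemma cantor_real_shift: "cantor_real a = (2 * a 0 + cantor_real (\<lambda>m. a (Suc m))) / 3"
proof -
  have "cantor_real (\<lambda>m. a (Suc m)) = (\<Sum>m. 3 * (2 * real_of_int (a (Suc m)) / 3 ^ Suc (Suc m)))"
    by (simp add: cantor_real_def)
  also have "\<dots> = 3 * (\<Sum>m. 2 * real_of_int (a (Suc m)) / 3 ^ Suc (Suc m))"
    using summable_cantor_real
    by (intro suminf_mult) (subst (asm) summable_Suc_iff[symmetric], simp)
  finally show ?thesis
    using suminf_split_head[OF summable_cantor_real] by (simp add: cantor_real_def)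
qed

end

text \<open>Schoenberg's choice of a function that is \<open>0\<close> on \<open>[0, 1/3]\<close>, \<open>1\<close> on \<open>[2/3, 1]\<close> and has
  period \<open>2\<close>: it reads off the leading ternary digit of the elements of the Cantor set.\<close>

definition schoenberg :: "real \<Rightarrow> real" where
  "schoenberg t = max 0 (min 1 (1/2 - cos (pi * t)))"

lemma schoenberg_bounds: "0 \<le> schoenberg t" "schoenberg t \<le> 1"
  by (auto simp: schoenberg_def)

lemma schoenberg_add_even: "schoenberg (2 * of_int N + t) = schoenberg t"
proof -
  have "cos (pi * (2 * of_int N + t)) = cos (pi * t + 2 * pi * of_int N)"
    by (simp add: algebra_simps)
  also have "\<dots> = cos (pi * t)"
    by (simp add: cos_add)
  finally show ?thesis
    by (simp add: schoenberg_def)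
qed

text \<open>A leading digit 0 puts the number into [0, 1/3], where the cosine is at least 1/2; a
  leading digit 1 puts it into [2/3, 1], where the cosine is at most -1/2. The truncation to [0, 1]
  then returns the digit exactly.\<close>

lemma schoenberg_cantor:
  assumes "\<And>m. 0 \<le> a m" "\<And>m. a m \<le> 1"
  shows "schoenberg (cantor_real a) = a 0"
proof -
  let ?u = "cantor_real (\<lambda>m. a (Suc m))"
  have u: "0 \<le> ?u" "?u \<le> 1"
    using assms by (auto intro!: cantor_real_bounds)
  have t: "cantor_real a = (2 * a 0 + ?u) / 3"
    by (rule cantor_real_shift) (use assms in auto)
  have "a 0 = 0 \<or> a 0 = 1"
    using assms(1)[of 0] assms(2)[of 0] by linarith
  then show ?thesis
  proof
    assume a0: "a 0 = 0"
    have "cos (pi / 3) \<le> cos (pi * cantor_real a)"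
      using u by (intro cos_monotone_0_pi_le) (auto simp: t a0)
    then show ?thesis
      by (simp add: schoenberg_def cos_60 a0)
  next
    assume a0: "a 0 = 1"
    have "cos (pi * cantor_real a) \<le> cos (pi - pi / 3)"
      using u by (intro cos_monotone_0_pi_le) (auto simp: t a0 field_simps)
    also have "\<dots> = - (1 / 2)"
      by (simp only: cos_pi_minus cos_60)
    finally show ?thesis
      by (simp add: schoenberg_def a0)
  qed
qed

text \<open>Tripling turns the leading digit into the even integer \<open>2 * a 0\<close>, which
  period 2 absorbs even after further multiplication by powers of 3; so each factor 3 exposes the
  next digit.\<close>

lemma schoenberg_power_cantor:
  assumes "\<And>m. 0 \<le> a m" "\<And>m. a m \<le> 1"
  shows "schoenberg (3 ^ m * cantor_real a) = a m"
  using assms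
proof (induction m arbitrary: a)
  case 0
  then show ?case
    using schoenberg_cantor[of a] by simp
next
  case (Suc m)
  let ?b = "\<lambda>m. a (Suc m)"
  have "cantor_real a = (2 * a 0 + cantor_real ?b) / 3"
    by (rule cantor_real_shift) (use Suc.prems in auto)
  then have "3 ^ m * (3 * cantor_real a) = 3 ^ m * (2 * a 0 + cantor_real ?b)"
    by simp
  then have "3 ^ Suc m * cantor_real a = 2 * of_int (3 ^ m * a 0) + 3 ^ m * cantor_real ?b"
    by (simp add: algebra_simps)
  then show ?case
    using Suc.IH[of ?b] Suc.prems by (simp only: schoenberg_add_even)
qed

lemma continuous_on_schoenberg: "continuous_on A schoenberg"
  unfolding schoenberg_def by (intro continuous_intros)

lemma sums_halves: "(\<lambda>k. 1 / 2 ^ Suc k :: real) sums 1"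
  using power_half_series by (simp add: power_divide)

text \<open>The positions \<open>k * n + j\<close> are those of the digits of one coordinate among
  \<open>n\<close> interleaved ones. Since \<open>schoenberg\<close> has values in [0, 1], the
  series is dominated by a geometric one and converges uniformly.\<close>

lemma continuous_on_schoenberg_series:
  "continuous_on UNIV (\<lambda>t. \<Sum>k. schoenberg (3 ^ (k * n + j) * t) / 2 ^ Suc k)"
proof -
  let ?S = "\<lambda>N t. \<Sum>k<N. schoenberg (3 ^ (k * n + j) * t) / 2 ^ Suc k"
  have "uniform_limit UNIV ?S (\<lambda>t. \<Sum>k. schoenberg (3 ^ (k * n + j) * t) / 2 ^ Suc k) sequentially"
    using schoenberg_bounds sums_summable[OF sums_halves]
    by (intro Weierstrass_m_test[where M = "\<lambda>k. 1 / 2 ^ Suc k"]) (auto intro!: divide_right_mono)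
  moreover have "continuous_on UNIV (?S N)" for N
    by (intro continuous_intros continuous_on_compose2[OF continuous_on_schoenberg[of UNIV]]) auto
  ultimately show ?thesis
    by (intro uniform_limit_theorem[where F = sequentially]) auto
qed

text \<open>The section \<open>\<sigma>\<close> interleaves the binary digits of the coordinates of \<open>y\<close> into the ternary digits
  of \<open>\<sigma> y\<close>.\<close>

proposition space_filling_curve:
  obtains p :: "real \<Rightarrow> real ^ 'n" and \<sigma> :: "real ^ 'n \<Rightarrow> real"
  where "continuous_on UNIV p" "\<sigma> \<in> borel_measurable borel"
    "\<And>y. 0 \<le> \<sigma> y" "\<And>y. \<sigma> y \<le> 1" "\<And>y. (\<And>i. 0 \<le> y $ i \<and> y $ i < 1) \<Longrightarrow> p (\<sigma> y) = y"
proof -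
  define n where "n = CARD('n)"
  have "n > 0"
    by (simp add: n_def)
  obtain e :: "nat \<Rightarrow> 'n" where e: "bij_betw e {0..<n} UNIV"
    using ex_bij_betw_nat_finite[of "UNIV :: 'n set"] by (auto simp: n_def)
  define j where "j = inv_into {0..<n} e"
  have j: "j i < n" "e (j i) = i" for i
    using e bij_betw_inv_into_right[OF e, of i] inv_into_into[of i e "{0..<n}"]
    by (auto simp: j_def bij_betw_def)
  define p :: "real \<Rightarrow> real ^ 'n"
    where "p t = (\<chi> i. \<Sum>k. schoenberg (3 ^ (k * n + j i) * t) / 2 ^ Suc k)" for t
  define a where "a y m = binary_digit (y $ e (m mod n)) (m div n)" for y :: "real ^ 'n" and m
  have a: "0 \<le> a y m" "a y m \<le> 1" for y m
    by (auto simp: a_def binary_digit_bounds)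
  show thesis
  proof
    show "continuous_on UNIV p"
      unfolding p_def by (intro continuous_on_vec_lambda continuous_on_schoenberg_series)
    have [measurable]: "(\<lambda>y. y $ i) \<in> borel_measurable borel" for i :: 'n
      by (intro borel_measurable_continuous_onI continuous_intros)
    have "(\<lambda>y. a y m) \<in> borel \<rightarrow>\<^sub>M count_space UNIV" for m
      unfolding a_def by measurable
    note [measurable] = this
    show "(\<lambda>y. cantor_real (a y)) \<in> borel_measurable borel"
      unfolding cantor_real_def by measurable
    show "0 \<le> cantor_real (a y)" "cantor_real (a y) \<le> 1" for y
      using cantor_real_bounds[of "a y"] a by auto
    fix y :: "real ^ 'n" assume y: "\<And>i. 0 \<le> y $ i \<and> y $ i < 1"
    have "schoenberg (3 ^ (k * n + j i) * cantor_real (a y)) = binary_digit (y $ i) k" for i k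
      using schoenberg_power_cantor[of "a y" "k * n + j i"] a j[of i] \<open>n > 0\<close> by (simp add: a_def)
    then show "p (cantor_real (a y)) = y"
      using y sums_binary_digit[of "y $ i" for i] by (simp add: p_def vec_eq_iff sums_iff)
  qed
qed

section \<open>Vague compactness\<close>

lemma bounded_compact_support:
  fixes f :: "'a::topological_space \<Rightarrow> real"
  assumes "continuous_on UNIV f" "compact (closure {x. f x \<noteq> 0})"
  obtains B where "B > 0" "\<And>x. \<bar>f x\<bar> \<le> B"
proof -
  have "bounded (f ` closure {x. f x \<noteq> 0})"
    using assms
    by (intro compact_imp_bounded compact_continuous_image continuous_on_subset[OF assms(1)]) auto
  then obtain B where B: "B > 0" "\<And>x. x \<in> closure {x. f x \<noteq> 0} \<Longrightarrow> \<bar>f x\<bar> \<le> B"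
    by (auto simp: bounded_pos)
  have "\<bar>f x\<bar> \<le> B" for x
    using B closure_subset[of "{x. f x \<noteq> 0}"] by (cases "f x = 0") auto
  then show thesis
    using that B(1) by blast
qed

section \<open>Space as the open unit cube\<close>

definition open_cube :: "(real ^ 'n) set" where
  "open_cube = {u. \<forall>i. 0 < u $ i \<and> u $ i < 1}"

definition to_cube :: "real ^ 'n \<Rightarrow> real ^ 'n" where
  "to_cube y = (\<chi> i. 1/2 + arctan (y $ i) / pi)"

definition from_cube :: "real ^ 'n \<Rightarrow> real ^ 'n" where
  "from_cube u = (\<chi> i. tan (pi * (u $ i - 1/2)))"

lemma open_open_cube: "open open_cube"
  unfolding open_cube_def Collect_all_eq
  by (intro open_INT ballI open_Collect_conj open_Collect_less continuous_intros) auto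

lemma to_cube_in: "to_cube y \<in> open_cube"
proof -
  have "0 < 1/2 + arctan t / pi" "1/2 + arctan t / pi < 1" for t :: real
    using arctan_bounded[of t] pi_gt_zero by (auto simp: field_simps)
  then show ?thesis
    by (auto simp: open_cube_def to_cube_def)
qed

lemma from_cube_to_cube: "from_cube (to_cube y) = y"
  by (simp add: from_cube_def to_cube_def tan_arctan vec_eq_iff)

lemma cube_angle_bounds:
  assumes "u \<in> open_cube"
  shows "- (pi / 2) < pi * (u $ i - 1/2)" "pi * (u $ i - 1/2) < pi / 2"
proof -
  have u: "0 < u $ i" "u $ i < 1"
    using assms by (auto simp: open_cube_def)
  have "pi * (- 1/2) < pi * (u $ i - 1/2)" "pi * (u $ i - 1/2) < pi * (1/2)"
    using u by (intro mult_strict_left_mono; simp)+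
  then show "- (pi / 2) < pi * (u $ i - 1/2)" "pi * (u $ i - 1/2) < pi / 2"
    by simp_all
qed

lemma to_cube_from_cube: "u \<in> open_cube \<Longrightarrow> to_cube (from_cube u) = u"
  using cube_angle_bounds[of u]
  by (simp add: from_cube_def to_cube_def vec_eq_iff arctan_tan)

lemma continuous_on_to_cube: "continuous_on A to_cube"
  unfolding to_cube_def by (intro continuous_intros) auto

lemma continuous_on_from_cube: "continuous_on open_cube (from_cube :: real ^ 'n \<Rightarrow> _)"
proof -
  have "cos (pi * (u $ i - 1/2)) \<noteq> 0" if "u \<in> open_cube" for u :: "real ^ 'n" and i
    using cube_angle_bounds[OF that, of i] cos_gt_zero_pi by fastforce
  then have "continuous_on open_cube (\<lambda>u :: real ^ 'n. tan (pi * (u $ i - 1/2)))" for i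
    unfolding tan_def by (intro continuous_intros ballI)
  then show ?thesis
    unfolding from_cube_def by (intro continuous_on_vec_lambda)
qed

text \<open>Needed on the whole space and not just on the cube, because the limit measure is pushed
  forward by \<open>from_cube\<close> composed with a curve that also leaves the open cube. Division
  being total, the quotient of sine and cosine is measurable everywhere.\<close>

lemma measurable_from_cube: "(from_cube :: real ^ 'n \<Rightarrow> _) \<in> borel_measurable borel"
proof (subst borel_measurable_euclidean_space, intro ballI)
  have [measurable]: "(\<lambda>u. u $ i) \<in> borel_measurable borel" for i :: 'n
    by (intro borel_measurable_continuous_onI continuous_intros)
  fix b :: "real ^ 'n" assume "b \<in> Basis"
  then obtain i where b: "b = axis i 1"
    by (auto simp: Basis_vec_def)
  show "(\<lambda>u. from_cube u \<bullet> b) \<in> borel_measurable borel"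
    unfolding b from_cube_def tan_def cart_eq_inner_axis[symmetric] vec_lambda_beta by measurable
qed

text \<open>A space-filling curve and its section reduce the claim to Helly's theorem on the compact
  interval \<open>[0, 1]\<close>; mass of the limit outside the open cube is mass that escapes to infinity.\<close>

theorem vague_compactness:
  fixes M :: "nat \<Rightarrow> (real ^ 'n) measure"
  assumes prob: "\<And>k. prob_space (M k)" and sets_M: "\<And>k. sets (M k) = sets borel"
  obtains \<phi> :: "nat \<Rightarrow> nat" and N :: "(real ^ 'n) measure"
  where "strict_mono \<phi>" "finite_measure N" "sets N = sets borel"
    "\<And>f :: real ^ 'n \<Rightarrow> real. continuous_on UNIV f \<Longrightarrow> compact (closure {x. f x \<noteq> 0}) \<Longrightarrow>
       (\<lambda>k. integral\<^sup>L (M (\<phi> k)) f) \<longlonglongrightarrow> integral\<^sup>L N f"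
proof -
  obtain p :: "real \<Rightarrow> real ^ 'n" and \<sigma> where cont_p: "continuous_on UNIV p"
    and \<sigma>: "\<sigma> \<in> borel_measurable borel" "\<And>y. 0 \<le> \<sigma> y" "\<And>y. \<sigma> y \<le> 1"
    and p\<sigma>: "\<And>y. (\<And>i. 0 \<le> y $ i \<and> y $ i < 1) \<Longrightarrow> p (\<sigma> y) = y"
    by (rule space_filling_curve[where 'n = 'n]) metis
  have p_to_cube: "p (\<sigma> (to_cube y)) = to_cube y" for y
    using to_cube_in[of y] by (intro p\<sigma>) (auto simp: open_cube_def less_imp_le)
  note [measurable_cong] = sets_M
  note [measurable] = \<sigma>(1) borel_measurable_continuous_onI[OF cont_p]
    borel_measurable_continuous_onI[OF continuous_on_to_cube] measurable_from_cube
    borel_open[OF open_open_cube]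
  define P where "P k = distr (M k) borel (\<lambda>y. \<sigma> (to_cube y))" for k
  have P: "real_distribution (P k)" for k
    unfolding real_distribution_def real_distribution_axioms_def P_def
    by (auto intro!: prob_space.prob_space_distr[OF prob])
  \<comment> \<open>Tightness is phrased with intervals open on the left, and
    \<open>\<sigma>\<close> may take the value 0; hence the endpoint -1.\<close>
  have "measure (P k) {-1<..1} = 1" for k
  proof -
    have "- 1 < \<sigma> y" for y
      using \<sigma>(2)[of y] by linarith
    then have "(\<lambda>y. \<sigma> (to_cube y)) -` {-1<..1} \<inter> space (M k) = space (M k)"
      using \<sigma> by auto
    then show ?thesis
      unfolding P_def using prob_space.prob_space[OF prob[of k]] by (subst measure_distr) auto
  qed
  then have "tight P"
    using P unfolding tight_def
    by (intro conjI allI impI exI[of _ "-1 :: real"] exI[of _ "1 :: real"]) auto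
  then obtain \<phi> L where \<phi>: "strict_mono \<phi>" and L: "real_distribution L"
    and conv: "weak_conv_m (P \<circ> id \<circ> \<phi>) L"
    using tight_imp_convergent_subsubsequence[of P id] by (auto simp: strict_mono_id)
  interpret L: real_distribution L
    by (fact L)
  define D where "D = density L (indicator (p -` open_cube))"
  define N where "N = distr D borel (\<lambda>t. from_cube (p t))"
  have [measurable_cong]: "sets D = sets borel"
    by (simp add: D_def)
  have [measurable]: "p -` open_cube \<in> sets borel"
    by (intro borel_open open_vimage open_open_cube cont_p)
  have fin_D: "finite_measure D"
  proof
    have "emeasure D (space D) \<le> (\<integral>\<^sup>+ t. 1 \<partial>L)"
      unfolding D_def by (subst emeasure_density) (auto intro!: emeasure_mono)
    also have "\<dots> = 1"
      using L.emeasure_space_1 by simp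
    finally show "emeasure D (space D) \<noteq> \<infinity>"
      by (auto simp: top_unique)
  qed
  show thesis
  proof
    show "strict_mono \<phi>"
      by fact
    show "finite_measure N"
      unfolding N_def by (intro finite_measure.finite_measure_distr[OF fin_D]) measurable
    show "sets N = sets borel"
      by (simp add: N_def)
    fix f :: "real ^ 'n \<Rightarrow> real"
    assume f: "continuous_on UNIV f" "compact (closure {x. f x \<noteq> 0})"
    note [measurable] = borel_measurable_continuous_onI[OF f(1)]
    \<comment> \<open>Extending by 0 is continuous because the support of \<open>f\<close> has a
      compact image in the cube: \<open>G\<close> is continuous on the open cube, zero on the open
      complement of that image, and these two open sets cover everything.\<close>
    define G where "G u = (if u \<in> open_cube then f (from_cube u) else 0)" for u
    have "continuous_on UNIV G"
    proof -
      let ?K = "to_cube ` closure {x. f x \<noteq> 0}"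
      have "compact ?K"
        by (intro compact_continuous_image continuous_on_to_cube f)
      then have "open (- ?K)"
        by (simp add: compact_imp_closed open_Compl)
      have "continuous_on open_cube (\<lambda>u. f (from_cube u))"
        by (rule continuous_on_compose2[OF f(1) continuous_on_from_cube]) auto
      then have 1: "continuous_on open_cube G"
        by (rule continuous_on_eq) (simp add: G_def)
      have "G u = 0" if "u \<notin> ?K" for u
      proof (rule ccontr)
        assume "G u \<noteq> 0"
        then have u: "u \<in> open_cube" "from_cube u \<in> {x. f x \<noteq> 0}"
          by (auto simp: G_def split: if_splits)
        then show False
          using that to_cube_from_cube[OF u(1)] imageI[OF subsetD[OF closure_subset u(2)], of to_cube]
          by simp
      qed
      then have "continuous_on (- ?K) (\<lambda>u. 0 :: real) = continuous_on (- ?K) G"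
        by (intro continuous_on_cong) auto
      then have 2: "continuous_on (- ?K) G"
        by simp
      have "continuous_on (open_cube \<union> - ?K) G"
        by (intro continuous_on_open_Un open_open_cube 1 2) fact
      moreover have "open_cube \<union> - ?K = UNIV"
        using to_cube_in by auto
      ultimately show ?thesis
        by simp
    qed
    then have Gp: "continuous_on UNIV (\<lambda>t. G (p t))"
      by (rule continuous_on_compose2[OF _ cont_p]) auto
    note [measurable] = borel_measurable_continuous_onI[OF Gp]
    obtain B where B: "B > 0" "\<And>x. \<bar>f x\<bar> \<le> B"
      using bounded_compact_support[OF f] by blast
    have "(\<lambda>k. integral\<^sup>L ((P \<circ> id \<circ> \<phi>) k) (\<lambda>t. G (p t))) \<longlonglongrightarrow> integral\<^sup>L L (\<lambda>t. G (p t))"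
    proof (rule weak_conv_imp_integral_bdd_continuous_conv)
      show "real_distribution ((P \<circ> id \<circ> \<phi>) n)" for n
        using P by simp
      show "norm (G (p t)) \<le> B" for t
        using B by (auto simp: G_def)
      show "isCont (\<lambda>t. G (p t)) t" for t
        using Gp by (simp add: continuous_on_eq_continuous_at)
    qed (fact L conv)+
    \<comment> \<open>The section property enters here: following \<open>\<sigma>\<close> by
      \<open>p\<close> gives back \<open>to_cube y\<close>, so no information is lost on the
      line.\<close>
    moreover have "integral\<^sup>L (P k) (\<lambda>t. G (p t)) = integral\<^sup>L (M k) f" for k
      unfolding P_def
      by (subst integral_distr) (auto simp: p_to_cube G_def to_cube_in from_cube_to_cube)
    moreover have "integral\<^sup>L N f = integral\<^sup>L L (\<lambda>t. G (p t))"
    proof -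
      have "integral\<^sup>L N f = integral\<^sup>L D (\<lambda>t. f (from_cube (p t)))"
        unfolding N_def by (subst integral_distr) auto
      also have "D = density L (\<lambda>t. ennreal (indicator (p -` open_cube) t))"
        unfolding D_def by (simp add: ennreal_indicator)
      also have "integral\<^sup>L \<dots> (\<lambda>t. f (from_cube (p t))) =
          integral\<^sup>L L (\<lambda>t. indicator (p -` open_cube) t *\<^sub>R f (from_cube (p t)))"
        by (subst integral_density) auto
      also have "\<dots> = integral\<^sup>L L (\<lambda>t. G (p t))"
        by (intro Bochner_Integration.integral_cong) (auto simp: G_def split: split_indicator)
      finally show ?thesis .
    qed
    ultimately show "(\<lambda>k. integral\<^sup>L (M (\<phi> k)) f) \<longlonglongrightarrow> integral\<^sup>L N f"
      by simp
  qed
qed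

section \<open>Radon measures on Euclidean space\<close>

text \<open>An open set is an increasing union of compact sets, so continuity from below is
  enough.\<close>

lemma emeasure_open_inner:
  fixes M :: "'a::euclidean_space measure"
  assumes sets_M: "sets M = sets borel" and "open V"
  shows "emeasure M V = (SUP K\<in>{K. compact K \<and> K \<subseteq> V}. emeasure M K)"
proof (rule antisym)
  obtain C where C: "\<And>n. compact (C n)" "\<And>n. C n \<subseteq> V" "\<And>n. C n \<subseteq> interior (C (Suc n))"
    "\<Union>(range C) = V"
    using open_Union_compact_subsets[OF \<open>open V\<close>] by metis
  have "incseq C"
    using C(3) interior_subset by (intro incseq_SucI) blast
  then have "emeasure M V = (SUP n. emeasure M (C n))"
    using C(1,4) sets_M by (subst SUP_emeasure_incseq) (auto intro: borel_compact)
  also have "\<dots> \<le> (SUP K\<in>{K. compact K \<and> K \<subseteq> V}. emeasure M K)"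
    using C(1,2) by (intro SUP_mono) auto
  finally show "emeasure M V \<le> (SUP K\<in>{K. compact K \<and> K \<subseteq> V}. emeasure M K)" .
  show "(SUP K\<in>{K. compact K \<and> K \<subseteq> V}. emeasure M K) \<le> emeasure M V"
    using \<open>open V\<close> sets_M by (intro SUP_least emeasure_mono) auto
qed

text \<open>Outer regularity of finite measures is applied to the restriction of \<open>M\<close> to
  each ball of radius \<open>n\<close>, with error \<open>e * (1/2) ^ Suc n\<close>. Cutting the
  resulting open sets back to their balls and taking the union still covers \<open>A\<close>, and
  the errors add up to \<open>e\<close>.\<close>

lemma outer_regular_locally_finite:
  fixes M :: "'a::euclidean_space measure"
  assumes sets_M [measurable_cong]: "sets M = sets borel"
    and fin: "\<And>r. emeasure M (cball 0 r) < \<infinity>"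
    and A [measurable]: "A \<in> sets borel" and "0 < (e::real)"
  obtains V where "open V" "A \<subseteq> V" "emeasure M V \<le> emeasure M A + e"
proof -
  have "\<exists>V. open V \<and> A \<subseteq> V \<and> emeasure M (V \<inter> ball 0 (real n) - A) \<le> e * (1/2) ^ Suc n" for n
  proof -
    let ?D = "density M (indicator (ball 0 (real n)))"
    have D: "emeasure ?D B = emeasure M (B \<inter> ball 0 (real n))" if "B \<in> sets borel" for B
    proof -
      have [measurable]: "B \<in> sets borel" "ball 0 (real n) \<in> sets (borel :: 'a measure)"
        using that by auto
      have "emeasure ?D B = (\<integral>\<^sup>+ x. indicator (ball 0 (real n)) x * indicator B x \<partial>M)"
        by (rule emeasure_density) auto
      also have "\<dots> = (\<integral>\<^sup>+ x. indicator (B \<inter> ball 0 (real n)) x \<partial>M)"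
        by (intro nn_integral_cong) (auto split: split_indicator)
      finally show ?thesis
        by (simp add: sets_M)
    qed
    have fin_ball: "emeasure M (ball 0 (real n)) < \<infinity>"
      by (rule le_less_trans[OF emeasure_mono fin[of n]]) (auto simp: sets_M)
    have fin_D: "emeasure ?D B < \<infinity>" if "B \<in> sets borel" for B
      unfolding D[OF that]
      by (rule le_less_trans[OF emeasure_mono fin_ball]) (auto simp: sets_M)
    have "emeasure ?D (space ?D) \<noteq> \<infinity>"
      using fin_D[of "space ?D"] sets_eq_imp_space_eq[OF sets_M] by simp
    then have "emeasure ?D A = (INF V\<in>{V. A \<subseteq> V \<and> open V}. emeasure ?D V)"
      by (intro outer_regular) (auto simp: sets_M)
    moreover have "emeasure ?D A < emeasure ?D A + ennreal (e * (1/2) ^ Suc n)"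
      using fin_D[OF A] \<open>0 < e\<close> by (simp add: ennreal_add_left_cancel_less)
    ultimately obtain V where V: "A \<subseteq> V" "open V"
      "emeasure ?D V < emeasure ?D A + ennreal (e * (1/2) ^ Suc n)"
      by (auto simp: INF_less_iff)
    have "emeasure ?D V = emeasure ?D A + emeasure ?D (V - A)"
      using V by (subst plus_emeasure) (auto simp: sets_M Un_absorb1 Un_Diff_cancel)
    then have "emeasure ?D (V - A) \<le> ennreal (e * (1/2) ^ Suc n)"
      using V(3) by (simp only: ennreal_add_left_cancel_less less_imp_le)
    moreover have "V \<inter> ball 0 (real n) - A = (V - A) \<inter> ball 0 (real n)"
      by auto
    ultimately show ?thesis
      using V D[of "V - A"] by auto
  qed
  then obtain V where V: "\<And>n. open (V n)" "\<And>n. A \<subseteq> V n"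
    "\<And>n. emeasure M (V n \<inter> ball 0 (real n) - A) \<le> e * (1/2) ^ Suc n"
    by metis
  let ?W = "\<Union>n. V n \<inter> ball 0 (real n)"
  show thesis
  proof
    show "open ?W"
      using V(1) by (intro open_UN ballI open_Int) auto
    show "A \<subseteq> ?W"
    proof
      fix x assume "x \<in> A"
      moreover obtain n where "norm x < real n"
        using reals_Archimedean2 by blast
      ultimately show "x \<in> ?W"
        using V(2) by auto
    qed
    have "emeasure M ?W \<le> emeasure M (A \<union> (?W - A))"
      using V(1) by (intro emeasure_mono) (auto simp: sets_M)
    also have "\<dots> \<le> emeasure M A + emeasure M (?W - A)"
      using V(1) by (intro emeasure_subadditive) (auto simp: sets_M)
    also have "?W - A = (\<Union>n. V n \<inter> ball 0 (real n) - A)"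
      by auto
    also have "emeasure M \<dots> \<le> (\<Sum>n. emeasure M (V n \<inter> ball 0 (real n) - A))"
      using V(1) by (intro emeasure_subadditive_countably) (auto simp: sets_M)
    also have "\<dots> \<le> (\<Sum>n. ennreal (e * (1/2) ^ Suc n))"
      by (intro suminf_le V(3)) auto
    also have "\<dots> = ennreal (e * 1)"
      using \<open>0 < e\<close> by (intro suminf_ennreal_eq sums_mult power_half_series) auto
    finally show "emeasure M ?W \<le> emeasure M A + e"
      by (simp add: add_left_mono)
  qed
qed

lemma radon_measureI:
  fixes M :: "'a::euclidean_space measure"
  assumes sets_M: "sets M = sets borel" and fin: "\<And>r. emeasure M (cball 0 r) < \<infinity>"
  shows "radon_measure M"
  unfolding radon_measure_def
proof (intro conjI allI impI ballI)
  fix K :: "'a set" assume "compact K"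
  then obtain r where "K \<subseteq> cball 0 r"
    using bounded_subset_ballD[OF compact_imp_bounded, of K 0] ball_subset_cball by blast
  then show "emeasure M K < \<infinity>"
    by (intro le_less_trans[OF emeasure_mono fin]) (auto simp: sets_M)
next
  fix A :: "'a set" assume A: "A \<in> sets borel"
  show "emeasure M A = (INF V\<in>{V. open V \<and> A \<subseteq> V}. emeasure M V)"
  proof (rule antisym)
    show "emeasure M A \<le> (INF V\<in>{V. open V \<and> A \<subseteq> V}. emeasure M V)"
      by (intro INF_greatest emeasure_mono) (auto simp: sets_M)
    show "(INF V\<in>{V. open V \<and> A \<subseteq> V}. emeasure M V) \<le> emeasure M A"
    proof (rule ennreal_le_epsilon)
      fix e :: real assume "0 < e"
      then obtain V where "open V" "A \<subseteq> V" "emeasure M V \<le> emeasure M A + e"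
        using outer_regular_locally_finite[OF sets_M fin A] by metis
      then show "(INF V\<in>{V. open V \<and> A \<subseteq> V}. emeasure M V) \<le> emeasure M A + e"
        by (intro INF_lower2[of V]) auto
    qed
  qed
qed (use sets_M emeasure_open_inner in auto)

lemma radon_measureD:
  fixes N :: "'a::euclidean_space measure"
  assumes "radon_measure N"
  shows "sets N = sets borel" "space N = UNIV" "\<And>K. compact K \<Longrightarrow> emeasure N K < \<infinity>"
  using assms sets_eq_imp_space_eq[of N borel] by (auto simp: radon_measure_def)

lemma emeasure_open_spt:
  fixes N :: "'a::second_countable_topology measure"
  assumes "sets N = sets borel" "open G" "G \<inter> spt N \<noteq> {}"
  shows "emeasure N G > 0"
proof -
  have "\<not> spt N \<subseteq> - G"
    using assms(3) by auto
  then have "emeasure N (- (- G)) \<noteq> 0"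
    using spt_least[OF assms(1), of "- G"] assms(2) by auto
  then show ?thesis
    by (simp add: zero_less_iff_neq_zero)
qed

lemma emeasure_disjoint_spt:
  fixes N :: "'a::second_countable_topology measure"
  assumes "sets N = sets borel" "A \<inter> spt N = {}"
  shows "emeasure N A = 0"
proof -
  have "emeasure N A \<le> emeasure N (- spt N)"
    using assms closed_spt[OF assms(1)] by (intro emeasure_mono) auto
  then show ?thesis
    using emeasure_Compl_spt[OF assms(1)] by simp
qed

section \<open>Cutoff functions\<close>

lemma integrable_compact_support:
  fixes f :: "'a::euclidean_space \<Rightarrow> real"
  assumes N: "radon_measure N" and f: "continuous_on UNIV f" "compact (closure {x. f x \<noteq> 0})"
  shows "integrable N f"
proof -
  note sets_N [measurable_cong] = radon_measureD(1)[OF N]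
  note [measurable] = borel_measurable_continuous_onI[OF f(1)]
  obtain B where B: "B > 0" "\<And>x. \<bar>f x\<bar> \<le> B"
    using bounded_compact_support[OF f] by blast
  have zero: "f x = 0" if "x \<notin> closure {x. f x \<noteq> 0}" for x
    using that subsetD[OF closure_subset, of x "{x. f x \<noteq> 0}"] by auto
  show ?thesis
  proof (rule Bochner_Integration.integrable_bound)
    show "integrable N (\<lambda>x. B * indicator (closure {x. f x \<noteq> 0}) x)"
      using radon_measureD(3)[OF N f(2)] by (auto simp: sets_N)
    have "\<bar>f x\<bar> \<le> \<bar>B * indicator (closure {x. f x \<noteq> 0}) x\<bar>" for x
      using B(1) B(2)[of x] zero[of x] by (cases "x \<in> closure {x. f x \<noteq> 0}") simp_all
    then show "AE x in N. norm (f x) \<le> norm (B * indicator (closure {x. f x \<noteq> 0}) x)"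
      by simp
  qed measurable
qed

text \<open>A Lipschitz bump that is at least 1 within distance \<open>\<delta>\<close> of
  \<open>K\<close> and 0 beyond \<open>2 * \<delta>\<close>. Letting it rise to 2 on
  \<open>K\<close> avoids a truncation from above and costs a factor 2 when integrals are compared
  with masses of sets.\<close>

definition cutoff :: "'a::metric_space set \<Rightarrow> real \<Rightarrow> 'a \<Rightarrow> real" where
  "cutoff K \<delta> y = max 0 (2 - infdist y K / \<delta>)"

context
  fixes K :: "'a::euclidean_space set" and \<delta> :: real
  assumes K: "compact K" "K \<noteq> {}" and \<delta>: "\<delta> > 0"
begin

lemma continuous_on_cutoff: "continuous_on UNIV (cutoff K \<delta>)"
  using \<delta> unfolding cutoff_def by (intro continuous_intros) auto

lemma cutoff_nonneg: "0 \<le> cutoff K \<delta> y"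
  by (simp add: cutoff_def)

lemma cutoff_le_2: "cutoff K \<delta> y \<le> 2"
  using \<delta> infdist_nonneg[of y K] by (simp add: cutoff_def)

lemma cutoff_ge_1: "infdist y K \<le> \<delta> \<Longrightarrow> 1 \<le> cutoff K \<delta> y"
  using \<delta> by (simp add: cutoff_def field_simps)

lemma cutoff_eq_0: "2 * \<delta> \<le> infdist y K \<Longrightarrow> cutoff K \<delta> y = 0"
  using \<delta> by (simp add: cutoff_def field_simps)

lemma compact_support_cutoff: "compact (closure {y. cutoff K \<delta> y \<noteq> 0})"
proof (rule compact_closure[THEN iffD2], rule bounded_subset)
  show "bounded {y. infdist y K \<le> 2 * \<delta>}"
    using K \<delta> by (intro compact_imp_bounded compact_infdist_le) auto
  show "{y. cutoff K \<delta> y \<noteq> 0} \<subseteq> {y. infdist y K \<le> 2 * \<delta>}"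
    using cutoff_eq_0 by force
qed

lemma measure_le_integral_cutoff:
  assumes N: "radon_measure N" and B: "B \<in> sets borel" "B \<subseteq> {y. infdist y K \<le> \<delta>}"
  shows "measure N B \<le> integral\<^sup>L N (cutoff K \<delta>)"
proof -
  have c: "compact {y. infdist y K \<le> \<delta>}"
    using K \<delta> by (intro compact_infdist_le) auto
  have "emeasure N B < \<infinity>"
    by (rule le_less_trans[OF emeasure_mono[OF B(2)] radon_measureD(3)[OF N c]])
      (simp add: radon_measureD(1)[OF N] borel_compact c)
  then have "integrable N (indicator B :: _ \<Rightarrow> real)"
    using B radon_measureD(1)[OF N] by (intro integrable_real_indicator) auto
  moreover have "indicator B y \<le> cutoff K \<delta> y" for y
    using B cutoff_ge_1 cutoff_nonneg by (auto split: split_indicator)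
  ultimately have "integral\<^sup>L N (indicator B) \<le> integral\<^sup>L N (cutoff K \<delta>)"
    using integrable_compact_support[OF N continuous_on_cutoff compact_support_cutoff]
    by (intro integral_mono)
  then show ?thesis
    by (simp add: radon_measureD(2)[OF N])
qed

lemma integral_cutoff_le:
  assumes N: "radon_measure N" and B: "compact B" "{y. infdist y K \<le> 2 * \<delta>} \<subseteq> B"
  shows "integral\<^sup>L N (cutoff K \<delta>) \<le> 2 * measure N B"
proof -
  have "cutoff K \<delta> y \<le> 2 * indicator B y" for y
  proof (cases "y \<in> B")
    case False
    then have "2 * \<delta> \<le> infdist y K"
      using subsetD[OF B(2), of y] by (cases "infdist y K \<le> 2 * \<delta>") auto
    then show ?thesis
      by (simp add: cutoff_eq_0)
  qed (simp add: cutoff_le_2)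
  moreover have "integrable N (\<lambda>y. 2 * indicator B y :: real)"
    using radon_measureD(3)[OF N B(1)] borel_compact[OF B(1)]
    by (auto simp: radon_measureD(1)[OF N])
  ultimately have "integral\<^sup>L N (cutoff K \<delta>) \<le> integral\<^sup>L N (\<lambda>y. 2 * indicator B y)"
    using integrable_compact_support[OF N continuous_on_cutoff compact_support_cutoff]
    by (intro integral_mono)
  then show ?thesis
    by (simp add: radon_measureD(2)[OF N])
qed

end

section \<open>Convergence of closed sets\<close>

text \<open>Eventual membership survives finite intersections and arbitrary unions, so testing the
  subbasis suffices. The miss set of the empty compact set yields the clause on closedness of
  \<open>E k\<close>.\<close>

lemma limitin_hit_and_miss:
  "limitin hit_and_miss E F net \<longleftrightarrow> closed F \<and> (\<forall>\<^sub>F k in net. closed (E k)) \<and>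
     (\<forall>K. compact K \<and> F \<inter> K = {} \<longrightarrow> (\<forall>\<^sub>F k in net. E k \<inter> K = {})) \<and>
     (\<forall>G. open G \<and> F \<inter> G \<noteq> {} \<longrightarrow> (\<forall>\<^sub>F k in net. E k \<inter> G \<noteq> {}))"
  (is "?L \<longleftrightarrow> ?R")
proof
  let ?S = "{{F. closed F \<and> F \<inter> K = {}} | K. compact K} \<union> {{F. closed F \<and> F \<inter> G \<noteq> {}} | G. open G}"
  assume L: ?L
  have F: "closed F"
    using limitin_topspace[OF L] by (simp add: topspace_hit_and_miss)
  have ev: "\<forall>\<^sub>F k in net. E k \<in> U" if "U \<in> ?S" "F \<in> U" for U
  proof -
    have "openin hit_and_miss U"
      unfolding hit_and_miss_def openin_topology_generated_by_iff
      using that(1) by (rule generate_topology_on.Basis)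
    then show ?thesis
      using L that(2) by (auto simp: limitin_def)
  qed
  have miss: "\<forall>\<^sub>F k in net. closed (E k) \<and> E k \<inter> K = {}" if "compact K" "F \<inter> K = {}" for K
    using ev[of "{F. closed F \<and> F \<inter> K = {}}"] that F by auto
  moreover have "\<forall>\<^sub>F k in net. closed (E k) \<and> E k \<inter> G \<noteq> {}" if "open G" "F \<inter> G \<noteq> {}" for G
    using ev[of "{F. closed F \<and> F \<inter> G \<noteq> {}}"] that F by auto
  ultimately show ?R
    using F miss[of "{}"] by (auto simp: eventually_conj_iff)
next
  assume R: ?R
  have "\<forall>\<^sub>F k in net. E k \<in> U"
    if "generate_topology_on ({{F. closed F \<and> F \<inter> K = {}} | K. compact K} \<union>
      {{F. closed F \<and> F \<inter> G \<noteq> {}} | G. open G}) U" "F \<in> U" for U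
    using that
  proof (induction U rule: generate_topology_on.induct)
    case Empty
    then show ?case by simp
  next
    case (Int a b)
    then show ?case by (auto intro: eventually_conj)
  next
    case (UN \<U>)
    then obtain U where "U \<in> \<U>" "\<forall>\<^sub>F k in net. E k \<in> U"
      by auto
    then show ?case by (auto elim: eventually_mono)
  next
    case (Basis U)
    have "\<forall>\<^sub>F k in net. closed (E k)"
      using R by blast
    from Basis(1) show ?case
    proof
      assume "U \<in> {{F. closed F \<and> F \<inter> K = {}} | K. compact K}"
      then obtain K where K: "compact K" and U: "U = {F. closed F \<and> F \<inter> K = {}}"
        by blast
      then have "\<forall>\<^sub>F k in net. E k \<inter> K = {}"
        using R Basis(2) by blast
      with \<open>\<forall>\<^sub>F k in net. closed (E k)\<close> show ?thesis
        unfolding U by eventually_elim simp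
    next
      assume "U \<in> {{F. closed F \<and> F \<inter> G \<noteq> {}} | G. open G}"
      then obtain G where G: "open G" and U: "U = {F. closed F \<and> F \<inter> G \<noteq> {}}"
        by blast
      moreover have "F \<inter> G \<noteq> {}"
        using Basis(2) U by simp
      ultimately have "\<forall>\<^sub>F k in net. E k \<inter> G \<noteq> {}"
        using R by simp
      with \<open>\<forall>\<^sub>F k in net. closed (E k)\<close> show ?thesis
        unfolding U by eventually_elim simp
    qed
  qed
  then show ?L
    using R unfolding limitin_def topspace_hit_and_miss
    by (auto simp: hit_and_miss_def openin_topology_generated_by_iff)
qed

text \<open>A point of one limit outside the other has a compact ball disjoint from the latter: the
  sets would eventually miss this ball and yet hit its interior.\<close>

lemma hit_and_miss_limit_unique:
  fixes F F' :: "'a::heine_borel set"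
  assumes "limitin hit_and_miss E F net" "limitin hit_and_miss E F' net" "net \<noteq> bot"
  shows "F = F'"
proof -
  have "A \<subseteq> B" if A: "limitin hit_and_miss E A net" and B: "limitin hit_and_miss E B net"
    for A B :: "'a set"
  proof
    fix y assume "y \<in> A"
    show "y \<in> B"
    proof (rule ccontr)
      assume "y \<notin> B"
      have "open (- B)"
        using B by (auto simp: limitin_hit_and_miss)
      then obtain e where e: "e > 0" "cball y e \<subseteq> - B"
        using \<open>y \<notin> B\<close> open_contains_cball by blast
      have "B \<inter> cball y e = {}"
        using e(2) by blast
      then have "\<forall>\<^sub>F k in net. E k \<inter> cball y e = {}"
        using B by (auto simp: limitin_hit_and_miss)
      moreover have "A \<inter> ball y e \<noteq> {}"
        using \<open>y \<in> A\<close> e(1) by auto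
      then have "\<forall>\<^sub>F k in net. E k \<inter> ball y e \<noteq> {}"
        using A by (auto simp: limitin_hit_and_miss)
      ultimately have "\<forall>\<^sub>F k in net. False"
        by eventually_elim (use ball_subset_cball[of y e] in blast)
      then show False
        using \<open>net \<noteq> bot\<close> by (simp add: trivial_limit_def)
    qed
  qed
  then show ?thesis
    using assms by blast
qed

section \<open>Blow-ups of regular measures\<close>

text \<open>The exponent \<open>0\<close> is allowed because a point mass is \<open>s\<close>-regular for every \<open>s\<close>: its support has
  diameter \<open>0\<close>.\<close>

locale regular_at =
  fixes M :: "'a::euclidean_space measure" and a :: 'a and s \<tau> R :: real
  assumes sets_M: "sets M = sets borel" and a: "a \<in> spt M"
    and s: "s \<ge> 0" and \<tau>: "\<tau> > 0" and R: "R > 0"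
    and lower: "\<And>y r. y \<in> spt M \<Longrightarrow> 0 < r \<Longrightarrow> r \<le> R \<Longrightarrow>
      ennreal (inverse \<tau> * r powr s) \<le> emeasure M (cball y r)"
    and upper: "\<And>r. 0 < r \<Longrightarrow> emeasure M (cball a r) \<le> ennreal (\<tau> * r powr s)"

text \<open>The cases follow the diameter of the support. If it is 0, the support is one atom, all
  balls around it have the same mass, and exponent 0 fits. If it is a positive \<open>D\<close>,
  then \<open>R = D\<close>, and beyond radius \<open>D\<close> the ball around \<open>a\<close>
  already contains the support, so its mass stops growing while the bound increases. If it is
  infinite, no radius is excluded.\<close>

lemma AD_regular_imp_regular_at:
  assumes M: "radon_measure M" and "AD_regular s M" and a: "a \<in> spt M" and s: "s > 0"
  obtains s' \<tau> R where "regular_at M a s' \<tau> R"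
proof -
  note sets_M = radon_measureD(1)[OF M]
  obtain \<tau> where \<tau>: "\<tau> > 0"
    and reg: "\<And>x r. x \<in> spt M \<Longrightarrow> 0 < r \<Longrightarrow> ennreal r \<le> ediameter (spt M) \<Longrightarrow>
      ennreal (inverse \<tau> * r powr s) \<le> emeasure M (cball x r) \<and>
      emeasure M (cball x r) \<le> ennreal (\<tau> * r powr s)"
    using assms(2) by (auto simp: AD_regular_def)
  have dist_le: "ennreal (dist a y) \<le> ediameter (spt M)" if "y \<in> spt M" for y
    unfolding ediameter_def using a that by (intro SUP_upper2[of "(a, y)"]) auto
  have emeasure_le: "emeasure M A \<le> emeasure M B" if "A \<inter> spt M \<subseteq> B" "A \<in> sets borel" "B \<in> sets borel" for A B
  proof -
    have "emeasure M A \<le> emeasure M (B \<union> (A - spt M))"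
      using that closed_spt[OF sets_M] by (intro emeasure_mono) (auto simp: sets_M)
    also have "\<dots> \<le> emeasure M B + emeasure M (A - spt M)"
      using that closed_spt[OF sets_M] by (intro emeasure_subadditive) (auto simp: sets_M)
    also have "emeasure M (A - spt M) = 0"
      using sets_M by (intro emeasure_disjoint_spt) auto
    finally show ?thesis
      by simp
  qed
  consider "ediameter (spt M) = 0" | D where "D > 0" "ediameter (spt M) = ennreal D"
    | "ediameter (spt M) = \<infinity>"
    by (cases "ediameter (spt M)") (auto simp: less_eq_real_def)
  then show thesis
  proof cases
    case 1
    have spt: "spt M = {a}"
    proof (intro equalityI subsetI)
      fix y assume "y \<in> spt M"
      then have "ennreal (dist a y) \<le> 0"
        using dist_le[of y] 1 by simp
      then show "y \<in> {a}"
        by (simp add: ennreal_eq_0_iff)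
    qed (use a in simp)
    define m where "m = measure M {a}"
    have "emeasure M {a} < \<infinity>"
      by (intro radon_measureD(3)[OF M]) auto
    then have m: "emeasure M {a} = ennreal m"
      by (simp add: m_def emeasure_eq_ennreal_measure top.not_eq_extremum)
    have ball: "emeasure M (cball a r) = ennreal m" if "r > 0" for r
      unfolding m[symmetric] using that spt by (intro antisym emeasure_le) auto
    have "a \<in> ball a 1 \<inter> spt M"
      using a by simp
    then have "0 < emeasure M (ball a 1)"
      using sets_M by (intro emeasure_open_spt) blast+
    also have "\<dots> \<le> emeasure M (cball a 1)"
      by (intro emeasure_mono) (auto simp: sets_M)
    finally have "m > 0"
      using ball[of 1] by (simp add: ennreal_eq_0_iff flip: zero_less_iff_neq_zero)
    \<comment> \<open>The constant \<open>m + inverse m\<close> dominates both \<open>m\<close> and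
      \<open>inverse m\<close>, so the mass \<open>m\<close> lies between its inverse and
      itself.\<close>
    have "inverse (m + inverse m) \<le> inverse (inverse m)"
      using \<open>m > 0\<close> by (intro le_imp_inverse_le) auto
    then have "inverse (m + inverse m) \<le> m" "m \<le> m + inverse m" "0 < m + inverse m"
      using \<open>m > 0\<close> by (auto intro: add_pos_pos)
    then have "regular_at M a 0 (m + inverse m) 1"
      using \<open>m > 0\<close> sets_M a by unfold_locales (auto simp: spt ball intro!: ennreal_leI)
    then show thesis
      by (rule that)
  next
    case (2 D)
    have "regular_at M a s \<tau> D"
    proof
      fix r :: real assume "r > 0"
      show "emeasure M (cball a r) \<le> ennreal (\<tau> * r powr s)"
      proof (cases "r \<le> D")
        case True
        then show ?thesis
          using reg[OF a \<open>r > 0\<close>] 2 by (auto intro: ennreal_leI)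
      next
        case False
        have "emeasure M (cball a r) \<le> emeasure M (cball a D)"
          using dist_le 2 by (intro emeasure_le) auto
        also have "\<dots> \<le> ennreal (\<tau> * D powr s)"
          using reg[OF a, of D] 2 by auto
        also have "\<dots> \<le> ennreal (\<tau> * r powr s)"
          using False 2 s \<tau> by (intro ennreal_leI mult_left_mono powr_mono2) auto
        finally show ?thesis .
      qed
    qed (use sets_M a s \<tau> 2 reg in \<open>auto intro: ennreal_leI\<close>)
    then show thesis
      by (rule that)
  next
    case 3
    have "regular_at M a s \<tau> 1"
      by unfold_locales (use sets_M a s \<tau> 3 reg in auto)
    then show thesis
      by (rule that)
  qed
qed

section \<open>Mass bounds for blow-ups and convergence of the dilated supports\<close>

context regular_at
begin

text \<open>Kept in the exact form that \<open>limit_models\<close> uses, so that unfolding is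
  enough in the end; proofs work with \<open>mem_dilation\<close>.\<close>

definition dilation :: "real \<Rightarrow> 'a set" where
  "dilation r = (\<lambda>y. (1 / r) *\<^sub>R y) ` translate (spt M) a"

lemma mem_dilation: "r > 0 \<Longrightarrow> y \<in> dilation r \<longleftrightarrow> a + r *\<^sub>R y \<in> spt M"
proof
  assume "r > 0" "a + r *\<^sub>R y \<in> spt M"
  then have "y = (1 / r) *\<^sub>R ((a + r *\<^sub>R y) - a)"
    by simp
  then show "y \<in> dilation r"
    unfolding dilation_def translate_def using \<open>a + r *\<^sub>R y \<in> spt M\<close> by blast
qed (auto simp: dilation_def translate_def)

lemma closed_dilation: "closed (dilation r)"
  unfolding dilation_def translate_def using closed_spt[OF sets_M]
  by (intro closed_scaling closed_translation_subtract)

lemma emeasure_blowup_cball: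
  assumes "r > 0"
  shows "emeasure (blowup M a r) (cball y \<delta>) = emeasure M (cball (a + r *\<^sub>R y) (r * \<delta>))"
proof -
  have "(\<lambda>z. a + r *\<^sub>R z) ` cball y \<delta> = (+) a ` ((*\<^sub>R) r ` cball y \<delta>)"
    by (simp add: image_image)
  also have "(*\<^sub>R) r ` cball y \<delta> = cball (r *\<^sub>R y) (r * \<delta>)"
    using assms cball_scale[of r y \<delta>] by simp
  also have "(+) a ` \<dots> = cball (a + r *\<^sub>R y) (r * \<delta>)"
    by (rule cball_translation[symmetric])
  finally show ?thesis
    using assms by (simp add: emeasure_blowup[OF sets_M])
qed

lemma emeasure_blowup_le:
  assumes "r > 0" "\<rho> > 0"
  shows "emeasure (blowup M a r) (cball 0 \<rho>) \<le> ennreal (\<tau> * (r powr s * \<rho> powr s))"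
  using upper[of "r * \<rho>"] assms by (simp add: emeasure_blowup_cball powr_mult)

lemma emeasure_blowup_ge:
  assumes "r > 0" "\<delta> > 0" "r * \<delta> \<le> R" "y \<in> dilation r"
  shows "ennreal (inverse \<tau> * (r powr s * \<delta> powr s)) \<le> emeasure (blowup M a r) (cball y \<delta>)"
  using lower[of "a + r *\<^sub>R y" "r * \<delta>"] assms
  by (simp add: emeasure_blowup_cball powr_mult mem_dilation)

lemma radon_blowup:
  assumes "r > 0"
  shows "radon_measure (blowup M a r)"
proof (rule radon_measureI)
  fix \<rho> :: real
  have "emeasure (blowup M a r) (cball 0 \<rho>) \<le> emeasure (blowup M a r) (cball 0 (max 1 \<rho>))"
    by (intro emeasure_mono) (auto simp: blowup_def)
  also have "\<dots> < \<infinity>"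
    using assms by (intro le_less_trans[OF emeasure_blowup_le]) auto
  finally show "emeasure (blowup M a r) (cball 0 \<rho>) < \<infinity>" .
qed (simp add: blowup_def)

lemma measure_blowup_le:
  assumes "r > 0" "\<rho> > 0"
  shows "measure (blowup M a r) (cball 0 \<rho>) \<le> \<tau> * (r powr s * \<rho> powr s)"
  using emeasure_blowup_le[OF assms] \<tau> by (simp add: measure_def enn2real_leI)

lemma measure_blowup_ge:
  assumes "r > 0" "\<delta> > 0" "r * \<delta> \<le> R" "y \<in> dilation r"
  shows "inverse \<tau> * (r powr s * \<delta> powr s) \<le> measure (blowup M a r) (cball y \<delta>)"
proof -
  have "emeasure (blowup M a r) (cball y \<delta>) = measure (blowup M a r) (cball y \<delta>)"
    using radon_measureD(3)[OF radon_blowup[OF assms(1)], of "cball y \<delta>"]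
    by (intro emeasure_eq_ennreal_measure) auto
  then show ?thesis
    using emeasure_blowup_ge[OF assms] by (simp add: ennreal_le_iff)
qed

lemma emeasure_blowup_disjoint:
  assumes "r > 0" "G \<in> sets borel" "dilation r \<inter> G = {}"
  shows "emeasure (blowup M a r) G = 0"
proof -
  have "(\<lambda>y. a + r *\<^sub>R y) ` G \<inter> spt M = {}"
    using assms mem_dilation by blast
  then show ?thesis
    using assms by (simp add: emeasure_blowup[OF sets_M] emeasure_disjoint_spt[OF sets_M])
qed

lemma zero_in_dilation: "r > 0 \<Longrightarrow> 0 \<in> dilation r"
  by (simp add: mem_dilation a)

text \<open>Hitting: an open set charged by \<open>N\<close> is eventually charged by the blow-ups
  and so meets the dilated support. Missing: \<open>K\<close> has positive distance from
  \<open>spt N\<close>, so the integrals of a cutoff around \<open>K\<close> tend to 0, whereas a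
  point of the dilated support in \<open>K\<close> would keep them above a fixed bound.\<close>

proposition dilation_tendsto_spt_tangent:
  fixes r c :: "nat \<Rightarrow> real"
  assumes N: "radon_measure N" "emeasure N UNIV \<noteq> 0"
    and r: "\<And>k. r k > 0" "r \<longlonglongrightarrow> 0" and c: "\<And>k. c k > 0"
    and conv: "\<And>f :: 'a \<Rightarrow> real. continuous_on UNIV f \<Longrightarrow> compact (closure {x. f x \<noteq> 0}) \<Longrightarrow>
      (\<lambda>k. c k * integral\<^sup>L (blowup M a (r k)) f) \<longlonglongrightarrow> integral\<^sup>L N f"
  shows "limitin hit_and_miss (\<lambda>k. dilation (r k)) (spt N) sequentially"
  unfolding limitin_hit_and_miss
proof (intro conjI allI impI; (elim conjE)?)
  note sets_N = radon_measureD(1)[OF N(1)]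
  have conv_cutoff: "(\<lambda>k. c k * integral\<^sup>L (blowup M a (r k)) (cutoff K \<delta>)) \<longlonglongrightarrow> integral\<^sup>L N (cutoff K \<delta>)"
    if "compact K" "K \<noteq> {}" "\<delta> > 0" for K \<delta>
    using that by (intro conv continuous_on_cutoff compact_support_cutoff)
  have pos: "integral\<^sup>L N (cutoff K \<delta>) > 0"
    if "compact K" "K \<noteq> {}" "\<delta> > 0" "B \<in> sets borel" "B \<subseteq> {y. infdist y K \<le> \<delta>}" "emeasure N B > 0" for K \<delta> B
  proof -
    have "emeasure N B \<le> emeasure N {y. infdist y K \<le> \<delta>}"
      using that by (intro emeasure_mono) (auto simp: sets_N compact_infdist_le borel_compact)
    also have "\<dots> < \<infinity>"
      using that by (intro radon_measureD(3)[OF N(1)] compact_infdist_le) auto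
    finally have "0 < measure N B"
      using that(6) by (simp add: measure_def enn2real_positive_iff)
    also have "\<dots> \<le> integral\<^sup>L N (cutoff K \<delta>)"
      using that N by (intro measure_le_integral_cutoff)
    finally show ?thesis .
  qed
  show "closed (spt N)"
    using sets_N by (rule closed_spt)
  show "\<forall>\<^sub>F k in sequentially. closed (dilation (r k))"
    by (simp add: closed_dilation)
  {
    fix G :: "'a set" assume G: "open G" "spt N \<inter> G \<noteq> {}"
    then obtain y where y: "y \<in> spt N" "y \<in> G"
      by blast
    obtain e where e: "e > 0" "cball y e \<subseteq> G"
      using G(1) y(2) open_contains_cball by blast
    have "y \<in> ball y (e / 2) \<inter> spt N"
      using y e by simp
    then have "0 < emeasure N (ball y (e / 2))"
      using sets_N by (intro emeasure_open_spt) blast+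
    \<comment> \<open>With width \<open>e / 2\<close> the cutoff is at least 1 on the charged ball
      and vanishes outside \<open>cball y e\<close>, hence outside \<open>G\<close>.\<close>
    then have "0 < integral\<^sup>L N (cutoff {y} (e / 2))"
      using e by (intro pos[where B = "ball y (e / 2)"]) (auto simp: dist_commute)
    then have "\<forall>\<^sub>F k in sequentially. 0 < c k * integral\<^sup>L (blowup M a (r k)) (cutoff {y} (e / 2))"
      using e by (intro order_tendstoD(1)[OF conv_cutoff]) auto
    then show "\<forall>\<^sub>F k in sequentially. dilation (r k) \<inter> G \<noteq> {}"
    proof eventually_elim
      case (elim k)
      show ?case
      proof
        assume "dilation (r k) \<inter> G = {}"
        then have "emeasure (blowup M a (r k)) (cball y e) = 0"
          using r(1) e(2) by (intro emeasure_blowup_disjoint) auto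
        moreover have "{z. infdist z {y} \<le> 2 * (e / 2)} \<subseteq> cball y e"
          by (auto simp: dist_commute)
        then have "integral\<^sup>L (blowup M a (r k)) (cutoff {y} (e / 2))
            \<le> 2 * measure (blowup M a (r k)) (cball y e)"
          using e(1) radon_blowup[OF r(1)] by (intro integral_cutoff_le) auto
        ultimately have "integral\<^sup>L (blowup M a (r k)) (cutoff {y} (e / 2)) \<le> 0"
          by (simp add: measure_def)
        then show False
          using elim c[of k] by (simp add: zero_less_mult_iff)
      qed
    qed
  next
    fix K :: "'a set" assume K: "compact K" "spt N \<inter> K = {}"
    show "\<forall>\<^sub>F k in sequentially. dilation (r k) \<inter> K = {}"
    proof (cases "K = {}")
      case False
      obtain e where e: "e > 0" "\<And>y z. y \<in> K \<Longrightarrow> z \<in> spt N \<Longrightarrow> e \<le> dist y z"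
        using separate_compact_closed[OF K(1) closed_spt[OF sets_N]] K(2) by (auto simp: Int_commute)
      \<comment> \<open>The cutoff reaches as far as \<open>2 * \<delta>\<close>, which is exactly
        the separation \<open>e\<close>, so it vanishes on \<open>spt N\<close>.\<close>
      define \<delta> where "\<delta> = e / 2"
      have "\<delta> > 0"
        using e by (simp add: \<delta>_def)
      have "integral\<^sup>L N (cutoff K \<delta>) = integral\<^sup>L N (\<lambda>y. 0)"
      proof (rule integral_cong_AE)
        have "cutoff K \<delta> z = 0" if "z \<in> spt N" for z
        proof (rule cutoff_eq_0[OF K(1) False \<open>\<delta> > 0\<close>])
          obtain y where "y \<in> K" "infdist z K = dist z y"
            using infdist_attains_inf[OF compact_imp_closed[OF K(1)] False] by metis
          then show "2 * \<delta> \<le> infdist z K"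
            using e(2)[OF \<open>y \<in> K\<close> that] by (simp add: \<delta>_def dist_commute)
        qed
        then have zero: "{z \<in> space N. cutoff K \<delta> z \<noteq> 0} \<subseteq> - spt N"
          by blast
        have "- spt N \<in> null_sets N"
          using closed_spt[OF sets_N] emeasure_Compl_spt[OF sets_N] by (auto simp: null_sets_def sets_N)
        from this zero show "AE z in N. cutoff K \<delta> z = 0"
          by (rule AE_I')
        show "cutoff K \<delta> \<in> borel_measurable N"
          using borel_measurable_continuous_onI[OF continuous_on_cutoff[OF K(1) False \<open>\<delta> > 0\<close>]] sets_N
          by (simp cong: measurable_cong_sets)
      qed simp
      then have small: "(\<lambda>k. c k * integral\<^sup>L (blowup M a (r k)) (cutoff K \<delta>)) \<longlonglongrightarrow> 0"
        using conv_cutoff[OF K(1) False \<open>\<delta> > 0\<close>] by simp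
      \<comment> \<open>Because \<open>N\<close> does not vanish, \<open>c k * r k powr s\<close> is bounded away from \<open>0\<close>; so a ball of radius
        \<open>\<delta>\<close> around a point of the dilated support carries too much mass to be missed by \<open>N\<close>.\<close>
      obtain \<rho> where \<rho>: "\<rho> > 0" "emeasure N (cball 0 \<rho>) > 0"
      proof (rule ccontr)
        assume *: "\<not> thesis"
        have "emeasure N (\<Union>n. cball 0 (real (Suc n))) = 0"
        proof (rule emeasure_UN_eq_0)
          show "emeasure N (cball 0 (real (Suc n))) = 0" for n
            using * that[of "real (Suc n)"] by (auto simp: zero_less_iff_neq_zero)
        qed (auto simp: sets_N)
        moreover have "(\<Union>n. cball (0 :: 'a) (real (Suc n))) = UNIV"
        proof (intro set_eqI iffI UNIV_I)
          fix x :: 'a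
          obtain n where "norm x < real n"
            using reals_Archimedean2 by blast
          then show "x \<in> (\<Union>n. cball 0 (real (Suc n)))"
            by (intro UN_I[of n]) auto
        qed
        ultimately show False
          using N(2) by simp
      qed
      define I where "I = integral\<^sup>L N (cutoff {0} \<rho>)"
      have "I > 0"
        unfolding I_def using \<rho> by (intro pos[where B = "cball 0 \<rho>"]) auto
      then have "\<forall>\<^sub>F k in sequentially. I / 2 < c k * integral\<^sup>L (blowup M a (r k)) (cutoff {0} \<rho>)"
        using \<rho>(1) by (intro order_tendstoD(1)[OF conv_cutoff]) (auto simp: I_def)
      \<comment> \<open>The last factor is the eventual lower bound for
        \<open>c k * r k powr s\<close>; its 4 combines the height 2 of the cutoff with the 2 in
        \<open>I / 2\<close>. The factor before it comes from the lower mass bound at radius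
        \<open>\<delta>\<close>.\<close>
      moreover define \<epsilon> where "\<epsilon> = inverse \<tau> * \<delta> powr s * (I / (4 * (\<tau> * (2 * \<rho>) powr s)))"
      have "\<epsilon> > 0"
        using \<open>I > 0\<close> \<tau> \<rho>(1) \<open>\<delta> > 0\<close> by (auto simp: \<epsilon>_def)
      then have "\<forall>\<^sub>F k in sequentially. c k * integral\<^sup>L (blowup M a (r k)) (cutoff K \<delta>) < \<epsilon>"
        by (rule order_tendstoD(2)[OF small])
      moreover have "\<forall>\<^sub>F k in sequentially. r k < R / \<delta>"
        using R \<open>\<delta> > 0\<close> by (intro order_tendstoD(2)[OF r(2)]) simp
      ultimately show ?thesis
      proof eventually_elim
        case (elim k)
        have "integral\<^sup>L (blowup M a (r k)) (cutoff {0} \<rho>) \<le> 2 * measure (blowup M a (r k)) (cball 0 (2 * \<rho>))"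
          using \<rho>(1) radon_blowup[OF r(1)] by (intro integral_cutoff_le) auto
        also have "\<dots> \<le> 2 * (\<tau> * (r k powr s * (2 * \<rho>) powr s))"
          using measure_blowup_le[OF r(1)[of k], of "2 * \<rho>"] \<rho>(1) by simp
        finally have "I / 2 < c k * (2 * (\<tau> * (r k powr s * (2 * \<rho>) powr s)))"
          using elim(1) c[of k] by (meson less_le_trans mult_left_mono less_imp_le)
        then have cr: "I / (4 * (\<tau> * (2 * \<rho>) powr s)) < c k * r k powr s"
          using \<tau> \<rho>(1) by (simp add: field_simps)
        show ?case
        proof (rule ccontr)
          assume "dilation (r k) \<inter> K \<noteq> {}"
          then obtain y where y: "y \<in> dilation (r k)" "y \<in> K"
            by blast
          have "\<epsilon> < inverse \<tau> * \<delta> powr s * (c k * r k powr s)"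
            unfolding \<epsilon>_def using cr \<tau> \<open>\<delta> > 0\<close> by (intro mult_strict_left_mono) auto
          also have "\<dots> = c k * (inverse \<tau> * (r k powr s * \<delta> powr s))"
            by (simp add: algebra_simps)
          also have "\<dots> \<le> c k * measure (blowup M a (r k)) (cball y \<delta>)"
            using elim(3) y(1) r(1)[of k] c[of k] \<open>\<delta> > 0\<close>
            by (intro mult_left_mono measure_blowup_ge) (auto simp: field_simps)
          also have "\<dots> \<le> c k * integral\<^sup>L (blowup M a (r k)) (cutoff K \<delta>)"
            using c[of k] y(2) K(1) False \<open>\<delta> > 0\<close> radon_blowup[OF r(1)]
            by (intro mult_left_mono measure_le_integral_cutoff)
              (auto intro: infdist_le2 simp: dist_commute)
          finally show False
            using elim(2) by simp
        qed
      qed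
    qed simp
  }
qed

end

section \<open>Existence of tangent measures\<close>

text \<open>A point with norm between \<open>m\<close> and \<open>m + 1\<close> is counted in the
  ball of radius \<open>m + 1\<close>. The weight (m+1)^-(s+2) against the mass C (m+1)^s leaves
  C/(m+1)^2: the 2 in the exponent makes the sum converge, to the value C pi^2/6.\<close>

lemma nn_integral_weight_le:
  fixes B :: "'a::euclidean_space measure"
  assumes sets_B: "sets B = sets borel" and "C \<ge> 0" and "s \<ge> 0"
    and le: "\<And>\<rho>. \<rho> > 0 \<Longrightarrow> emeasure B (cball 0 \<rho>) \<le> ennreal (C * \<rho> powr s)"
  shows "(\<integral>\<^sup>+ y. ennreal ((1 + norm y) powr (- (s + 2))) \<partial>B) \<le> ennreal (C * (pi\<^sup>2 / 6))"
proof -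
  let ?w = "\<lambda>n. (real n + 1) powr (- (s + 2))"
  have "ennreal ((1 + norm y) powr (- (s + 2))) \<le>
      (\<Sum>n. ennreal (?w n) * indicator (cball 0 (real n + 1)) y)" for y :: 'a
  proof -
    define m where "m = nat \<lfloor>norm y\<rfloor>"
    have m: "real m \<le> norm y" "norm y \<le> real m + 1"
      unfolding m_def by simp_all
    have "ennreal ((1 + norm y) powr (- (s + 2))) \<le> ennreal (?w m)"
      using m \<open>s \<ge> 0\<close> by (intro ennreal_leI powr_mono2') auto
    also have "\<dots> = (\<Sum>n\<in>{m}. ennreal (?w n) * indicator (cball 0 (real n + 1)) y)"
      using m by simp
    also have "\<dots> \<le> (\<Sum>n. ennreal (?w n) * indicator (cball 0 (real n + 1)) y)"
      by (rule sum_le_suminf) auto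
    finally show ?thesis .
  qed
  then have "(\<integral>\<^sup>+ y. ennreal ((1 + norm y) powr (- (s + 2))) \<partial>B) \<le>
      (\<integral>\<^sup>+ y. (\<Sum>n. ennreal (?w n) * indicator (cball 0 (real n + 1)) y) \<partial>B)"
    by (intro nn_integral_mono)
  also have "\<dots> = (\<Sum>n. \<integral>\<^sup>+ y. ennreal (?w n) * indicator (cball 0 (real n + 1)) y \<partial>B)"
    by (intro nn_integral_suminf borel_measurable_times_ennreal borel_measurable_const
        borel_measurable_indicator) (simp add: sets_B)
  also have "\<dots> = (\<Sum>n. ennreal (?w n) * emeasure B (cball 0 (real n + 1)))"
    by (intro suminf_cong nn_integral_cmult_indicator) (simp add: sets_B)
  also have "\<dots> \<le> (\<Sum>n. ennreal (C * (1 / (real n + 1)\<^sup>2)))"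
  proof (intro suminf_le summableI)
    fix n
    have "ennreal (?w n) * emeasure B (cball 0 (real n + 1)) \<le>
        ennreal (?w n) * ennreal (C * (real n + 1) powr s)"
      by (intro mult_left_mono le) auto
    also have "\<dots> = ennreal (C * (?w n * (real n + 1) powr s))"
      using \<open>C \<ge> 0\<close> by (simp add: mult_ac flip: ennreal_mult)
    also have "?w n * (real n + 1) powr s = (real n + 1) powr (- 2)"
      by (simp flip: powr_add)
    also have "\<dots> = 1 / (real n + 1)\<^sup>2"
      by (simp add: powr_minus powr_numeral divide_inverse)
    finally show "ennreal (?w n) * emeasure B (cball 0 (real n + 1)) \<le> ennreal (C * (1 / (real n + 1)\<^sup>2))" .
  qed
  also have "\<dots> = ennreal (C * (pi\<^sup>2 / 6))"
    using \<open>C \<ge> 0\<close> inverse_squares_sums by (intro suminf_ennreal_eq sums_mult) (auto simp: add_ac)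
  finally show ?thesis .
qed

text \<open>The weight \<open>(1 + norm y) powr - (s + 2)\<close> is integrable uniformly over all blow-ups; it turns them
  into probability measures, to which vague compactness applies, and is then divided out of the limit.\<close>

proposition tangent_measure_exists:
  fixes M :: "(real ^ 'n) measure" and r :: "nat \<Rightarrow> real"
  assumes "regular_at M a s \<tau> R" and r: "\<And>k. r k > 0" "r \<longlonglongrightarrow> 0"
  obtains \<phi> :: "nat \<Rightarrow> nat" and c :: "nat \<Rightarrow> real" and N
  where "strict_mono \<phi>" "\<And>k. c k > 0" "radon_measure N" "emeasure N UNIV \<noteq> 0"
    "\<And>f :: real ^ 'n \<Rightarrow> real. continuous_on UNIV f \<Longrightarrow> compact (closure {x. f x \<noteq> 0}) \<Longrightarrow>
       (\<lambda>k. c k * integral\<^sup>L (blowup M a (r (\<phi> k))) f) \<longlonglongrightarrow> integral\<^sup>L N f"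
proof -
  interpret regular_at M a s \<tau> R
    by fact
  define B where "B k = blowup M a (r k)" for k
  have radon_B: "radon_measure (B k)" for k
    unfolding B_def by (intro radon_blowup r)
  note sets_B [measurable_cong] = radon_measureD(1)[OF radon_B]
  define w :: "real ^ 'n \<Rightarrow> real" where "w y = (1 + norm y) powr (- (s + 2))" for y
  define v :: "real ^ 'n \<Rightarrow> real" where "v y = (1 + norm y) powr (s + 2)" for y
  have cont: "continuous_on UNIV w" "continuous_on UNIV v"
    unfolding w_def v_def using norm_ge_zero by (intro continuous_intros; force simp: add_nonneg_eq_0_iff)+
  note [measurable] = cont[THEN borel_measurable_continuous_onI]
  have pos: "w y > 0" "v y > 0" "w y * v y = 1" for y
  proof -
    have "1 + norm y > 0"
      using norm_ge_zero[of y] by linarith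
    then show "w y > 0" "v y > 0" "w y * v y = 1"
      by (simp_all add: w_def v_def flip: powr_add)
  qed
  define W where "W k = (\<integral>\<^sup>+ y. ennreal (w y) \<partial>B k)" for k
  \<comment> \<open>The constant of \<open>nn_integral_weight_le\<close>, which is applied with
    \<open>C = \<tau> * r k powr s\<close>.\<close>
  define S where "S = pi\<^sup>2 / (6 :: real)"
  have "S > 0"
    by (simp add: S_def)
  have W_le: "W k \<le> ennreal (\<tau> * r k powr s * S)" for k
    unfolding W_def w_def S_def using emeasure_blowup_le[OF r(1)[of k]] \<tau> s
    by (intro nn_integral_weight_le sets_B) (auto simp: B_def mult.assoc)
  have W_pos: "W k > 0" for k
  proof -
    have "a \<in> ball a (r k) \<inter> spt M"
      using r(1)[of k] a by simp
    then have "0 < emeasure M (ball a (r k))"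
      using sets_M by (intro emeasure_open_spt) blast+
    also have "\<dots> \<le> emeasure M (cball a (r k))"
      by (intro emeasure_mono) (auto simp: sets_M)
    also have "\<dots> = emeasure (B k) (cball 0 1)"
      using r(1)[of k] by (simp add: B_def emeasure_blowup_cball)
    also have "\<dots> \<le> emeasure (B k) {y \<in> space (B k). ennreal (w y) \<noteq> 0}"
      using pos(1) by (intro emeasure_mono) (auto simp: sets_B radon_measureD(2)[OF radon_B] less_le)
    finally show ?thesis
      unfolding W_def by (subst zero_less_iff_neq_zero, subst nn_integral_0_iff) auto
  qed
  have W_top: "W k < top" for k
    using W_le[of k] ennreal_less_top by (rule le_less_trans)
  then have W: "ennreal (enn2real (W k)) = W k" for k
    by simp
  have W_real: "0 < enn2real (W k)" "enn2real (W k) \<le> \<tau> * r k powr s * S" for k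
    using W_pos[of k] W_top[of k] W_le[of k] \<tau> \<open>S > 0\<close>
    by (auto simp: enn2real_positive_iff intro!: enn2real_leI)
  define c where "c k = 1 / enn2real (W k)" for k
  have c: "c k > 0" for k
    using W_real by (simp add: c_def)
  define P where "P k = density (B k) (\<lambda>y. ennreal (c k * w y))" for k
  have "prob_space (P k)" for k
  proof
    have "emeasure (P k) (space (P k)) = (\<integral>\<^sup>+ y. ennreal (c k) * ennreal (w y) \<partial>B k)"
      unfolding P_def using c[of k] pos(1)
      by (subst emeasure_density) (auto intro!: nn_integral_cong simp: less_imp_le ennreal_mult)
    also have "\<dots> = ennreal (c k) * W k"
      unfolding W_def by (intro nn_integral_cmult) measurable
    also have "\<dots> = ennreal (c k * enn2real (W k))"
      using c[of k] by (subst W[symmetric]) (simp add: ennreal_mult less_imp_le)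
    also have "c k * enn2real (W k) = 1"
      using W_real(1)[of k] by (simp add: c_def)
    finally show "emeasure (P k) (space (P k)) = 1"
      by simp
  qed
  moreover have "sets (P k) = sets borel" for k
    by (simp add: P_def sets_B)
  ultimately obtain \<phi> N0 where \<phi>: "strict_mono \<phi>" and N0: "finite_measure N0"
    and sets_N0 [measurable_cong]: "sets N0 = sets borel"
    and conv: "\<And>f :: real ^ 'n \<Rightarrow> real. continuous_on UNIV f \<Longrightarrow> compact (closure {x. f x \<noteq> 0}) \<Longrightarrow>
      (\<lambda>k. integral\<^sup>L (P (\<phi> k)) f) \<longlonglongrightarrow> integral\<^sup>L N0 f"
    using vague_compactness[of P] by metis
  interpret N0: finite_measure N0
    by (fact N0)
  define N where "N = density N0 (\<lambda>y. ennreal (v y))"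
  have sets_N: "sets N = sets borel"
    by (simp add: N_def sets_N0)
  have "radon_measure N"
  proof (rule radon_measureI[OF sets_N])
    fix \<rho> :: real
    have "emeasure N (cball 0 \<rho>) = (\<integral>\<^sup>+ y. ennreal (v y) * indicator (cball 0 \<rho>) y \<partial>N0)"
      unfolding N_def by (intro emeasure_density) (auto simp: sets_N0)
    also have "\<dots> \<le> (\<integral>\<^sup>+ y. ennreal ((1 + \<bar>\<rho>\<bar>) powr (s + 2)) \<partial>N0)"
      using s by (intro nn_integral_mono) (auto simp: v_def intro!: ennreal_leI powr_mono2 split: split_indicator)
    also have "\<dots> < \<infinity>"
      by (simp add: ennreal_mult_eq_top_iff flip: less_top)
    finally show "emeasure N (cball 0 \<rho>) < \<infinity>" .
  qed
  have conv_N: "(\<lambda>k. c (\<phi> k) * integral\<^sup>L (B (\<phi> k)) f) \<longlonglongrightarrow> integral\<^sup>L N f"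
    if f: "continuous_on UNIV f" "compact (closure {x. f x \<noteq> 0})" for f
  proof -
    note [measurable] = borel_measurable_continuous_onI[OF f(1)]
    \<comment> \<open>Since \<open>v\<close> is continuous and positive, \<open>v * f\<close> is
      again an admissible test function; against \<open>P k\<close> its factor \<open>v\<close>
      cancels the weight \<open>w\<close>.\<close>
    have "{x. v x * f x \<noteq> 0} = {x. f x \<noteq> 0}"
      using pos(2) by (auto simp: less_le)
    then have "(\<lambda>k. integral\<^sup>L (P (\<phi> k)) (\<lambda>x. v x * f x)) \<longlonglongrightarrow> integral\<^sup>L N0 (\<lambda>x. v x * f x)"
      using f by (intro conv continuous_on_mult cont) auto
    moreover have "integral\<^sup>L (P k) (\<lambda>x. v x * f x) = c k * integral\<^sup>L (B k) f" for k
    proof -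
      have "integral\<^sup>L (P k) (\<lambda>x. v x * f x) = integral\<^sup>L (B k) (\<lambda>x. (c k * w x) *\<^sub>R (v x * f x))"
        unfolding P_def using c[of k] pos(1) by (intro integral_density) (auto simp: less_imp_le)
      also have "(\<lambda>x. (c k * w x) *\<^sub>R (v x * f x)) = (\<lambda>x. c k * (w x * v x * f x))"
        by (simp add: mult_ac)
      finally show ?thesis
        by (simp add: pos(3))
    qed
    moreover have "integral\<^sup>L N f = integral\<^sup>L N0 (\<lambda>x. v x *\<^sub>R f x)"
      unfolding N_def using pos(2) by (intro integral_density) (auto simp: less_imp_le)
    ultimately show ?thesis
      by simp
  qed
  have "emeasure N UNIV \<noteq> 0"
  proof
    assume "emeasure N UNIV = 0"
    let ?f = "cutoff {0 :: real ^ 'n} 1"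
    have "UNIV \<in> null_sets N"
      using \<open>emeasure N UNIV = 0\<close> by (auto simp: null_sets_def sets_N)
    then have "AE y in N. ?f y = 0"
      by (rule AE_I') auto
    then have "integral\<^sup>L N ?f = 0"
      by (rule integral_eq_zero_AE)
    moreover have "(\<lambda>k. c (\<phi> k) * integral\<^sup>L (B (\<phi> k)) ?f) \<longlonglongrightarrow> integral\<^sup>L N ?f"
      by (intro conv_N continuous_on_cutoff compact_support_cutoff) auto
    \<comment> \<open>The upper bound on \<open>W\<close> makes \<open>c\<close> at least
      \<open>1 / (\<tau> * r powr s * S)\<close>, and the unit ball of the blow-up has mass at least
      \<open>inverse \<tau> * r powr s\<close>. The powers of the scale cancel, which prevents the
      limit from vanishing.\<close>
    moreover have "\<forall>\<^sub>F k in sequentially. inverse \<tau> / (\<tau> * S) \<le> c (\<phi> k) * integral\<^sup>L (B (\<phi> k)) ?f"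
    proof -
      have "\<forall>\<^sub>F k in sequentially. r k < R"
        using r(2) R by (rule order_tendstoD)
      then have "\<forall>\<^sub>F k in sequentially. r (\<phi> k) < R"
        by (rule eventually_subseq[OF \<phi>])
      then show ?thesis
      proof eventually_elim
        case (elim k)
        let ?r = "r (\<phi> k)"
        have "inverse \<tau> / (\<tau> * S) = 1 / (\<tau> * ?r powr s * S) * (inverse \<tau> * ?r powr s)"
          using r(1)[of "\<phi> k"] \<tau> \<open>S > 0\<close> by (simp add: field_simps)
        also have "\<dots> \<le> c (\<phi> k) * (inverse \<tau> * ?r powr s)"
          unfolding c_def using W_real[of "\<phi> k"] \<tau> by (intro mult_right_mono divide_left_mono) auto
        also have "\<dots> \<le> c (\<phi> k) * measure (B (\<phi> k)) (cball 0 1)"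
          using measure_blowup_ge[of ?r 1 0] r(1)[of "\<phi> k"] elim c[of "\<phi> k"] zero_in_dilation[of ?r]
          by (intro mult_left_mono) (auto simp: B_def)
        also have "\<dots> \<le> c (\<phi> k) * integral\<^sup>L (B (\<phi> k)) ?f"
          using c[of "\<phi> k"] radon_B by (intro mult_left_mono measure_le_integral_cutoff) auto
        finally show ?case .
      qed
    qed
    ultimately have "inverse \<tau> / (\<tau> * S) \<le> 0"
      by (intro tendsto_lowerbound[of _ 0 sequentially]) auto
    moreover have "0 < inverse \<tau> / (\<tau> * S)"
      using \<tau> \<open>S > 0\<close> by simp
    ultimately show False
      by simp
  qed
  show thesis
  proof
    show "(\<lambda>k. c (\<phi> k) * integral\<^sup>L (blowup M a (r (\<phi> k))) f) \<longlonglongrightarrow> integral\<^sup>L N f"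
      if "continuous_on UNIV f" "compact (closure {x. f x \<noteq> 0})" for f
      using conv_N[OF that] by (simp add: B_def)
  qed fact+
qed

theorem theorem1p3:
  fixes \<mu> :: "(real ^ 'n) measure" and s :: real
  assumes "s > 0"
    and "radon_measure \<mu>"
    and "AD_regular s \<mu>"
    and "x \<in> spt \<mu>"
  shows "limit_models (translate (spt \<mu>) x) = {spt \<nu> | \<nu>. \<nu> \<in> Tan \<mu> x}"
proof -
  obtain s' \<tau> R where reg: "regular_at \<mu> x s' \<tau> R"
    using AD_regular_imp_regular_at[OF assms(2,3,4,1)] .
  interpret regular_at \<mu> x s' \<tau> R
    by (fact reg)
  show ?thesis
  proof (intro equalityI subsetI)
    fix F assume "F \<in> limit_models (translate (spt \<mu>) x)"
    then obtain r :: "nat \<Rightarrow> real" where r: "\<And>k. r k > 0" "r \<longlonglongrightarrow> 0"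
      and F: "limitin hit_and_miss (\<lambda>k. dilation (r k)) F sequentially"
      by (auto simp: limit_models_def dilation_def)
    show "F \<in> {spt \<nu> | \<nu>. \<nu> \<in> Tan \<mu> x}"
    proof (rule tangent_measure_exists[OF reg r])
      fix \<phi> :: "nat \<Rightarrow> nat" and c :: "nat \<Rightarrow> real" and \<nu>
      assume \<phi>: "strict_mono \<phi>" and c: "\<And>k. c k > 0"
        and \<nu>: "radon_measure \<nu>" "emeasure \<nu> UNIV \<noteq> 0"
        and conv: "\<And>f :: real ^ 'n \<Rightarrow> real. continuous_on UNIV f \<Longrightarrow>
          compact (closure {x. f x \<noteq> 0}) \<Longrightarrow>
          (\<lambda>k. c k * integral\<^sup>L (blowup \<mu> x (r (\<phi> k))) f) \<longlonglongrightarrow> integral\<^sup>L \<nu> f"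
      have r\<phi>: "r (\<phi> k) > 0" "(\<lambda>k. r (\<phi> k)) \<longlonglongrightarrow> 0" for k
        using r(1) LIMSEQ_subseq_LIMSEQ[OF r(2) \<phi>] by (auto simp: o_def)
      have "limitin hit_and_miss (\<lambda>k. dilation (r (\<phi> k))) (spt \<nu>) sequentially"
        by (rule dilation_tendsto_spt_tangent[OF \<nu> r\<phi> c conv])
      \<comment> \<open>Passing to the subsequence preserves the limit \<open>F\<close>, so both
        limits belong to the same sequence of sets.\<close>
      moreover have "limitin hit_and_miss (\<lambda>k. dilation (r (\<phi> k))) F sequentially"
        using limitin_subsequence[OF \<phi> F] by (simp add: o_def)
      ultimately have "F = spt \<nu>"
        by (intro hit_and_miss_limit_unique[of _ F sequentially]) auto
      moreover have "\<nu> \<in> Tan \<mu> x"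
        unfolding Tan_def using \<nu> r\<phi> c conv
        by (intro CollectI conjI exI[of _ "\<lambda>k. r (\<phi> k)"] exI[of _ c] allI impI; (elim conjE)?; blast)
      ultimately show "F \<in> {spt \<nu> | \<nu>. \<nu> \<in> Tan \<mu> x}"
        by blast
    qed
  next
    fix F assume "F \<in> {spt \<nu> | \<nu>. \<nu> \<in> Tan \<mu> x}"
    then obtain \<nu> where F: "F = spt \<nu>" and "\<nu> \<in> Tan \<mu> x"
      by blast
    then obtain r c :: "nat \<Rightarrow> real" where \<nu>: "radon_measure \<nu>" "emeasure \<nu> UNIV \<noteq> 0"
      and r: "\<And>k. r k > 0" "r \<longlonglongrightarrow> 0" and c: "\<And>k. c k > 0"
      and conv: "\<And>f :: real ^ 'n \<Rightarrow> real. continuous_on UNIV f \<Longrightarrow> compact (closure {x. f x \<noteq> 0}) \<Longrightarrow>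
        (\<lambda>k. c k * integral\<^sup>L (blowup \<mu> x (r k)) f) \<longlonglongrightarrow> integral\<^sup>L \<nu> f"
      unfolding Tan_def by blast
    have "limitin hit_and_miss (\<lambda>k. dilation (r k)) F sequentially"
      unfolding F by (rule dilation_tendsto_spt_tangent[OF \<nu> r c conv])
    moreover have "closed F"
      unfolding F by (intro closed_spt radon_measureD \<nu>)
    ultimately show "F \<in> limit_models (translate (spt \<mu>) x)"
      unfolding limit_models_def dilation_def using r by (intro CollectI conjI exI[of _ r]) auto
  qed
qed

end
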